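(* Let $f(x,y)$ be a rational function, $(x_0,y_0)\in\mathbb{R}^2$ and $a\in\mathbb{R}$. Then $\lim_{(x,y)\to(x_0,y_0)}f(x,y)$ exists and equals $a$ if and only if for every function $\Phi_N$ of type $\mathcal{I}$ the limits $$\lim_{x\to x_0}f(x,\,y_0+\Phi_N(x-x_0))=a,\qquad \lim_{y\to y_0}f(x_0+\Phi_N(y-y_0),\,y)=a$$ exist and equal $a$.
   Context: A rational function of two real arguments is $f=p/q$ with $p,q$ mutually prime real polynomials in $x,y$, $q\ne0$. Convention: whenever the iterated limit $\lim_{x\to x_0}\lim_{y\to y_0}f(x,y)$ is finite, one sets $f(x_0,y_0)$ equal to it. A function of type $\mathcal{I}$ is $\Phi_N(t)=\sum_{k=1}^N\phi_k|t|^{e_k}$ with $N\in\mathbb{Z}^+=\{0,1,2,\dots\}$, $\phi_k\in\mathbb{R}\setminus\{0\}$, $e_k\in\mathbb{Q}$, $1\le e_1<\dots<e_N$ (and $\Phi_0(t)=0$). *)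

theory Defs
  imports "HOL-Analysis.Analysis" "HOL-Computational_Algebra.Polynomial"
begin

(* Limits of partial functions are taken along the domain, which has to accumulate at the
   point: without that condition the filter could be trivial and every real would be a limit. *)
definition has_limit :: "('a::topological_space \<rightharpoonup> real) \<Rightarrow> 'a \<Rightarrow> real \<Rightarrow> bool" where
  "has_limit f z a \<longleftrightarrow>
     z islimpt dom f \<and> ((\<lambda>w. the (f w)) \<longlongrightarrow> a) (at z within dom f)"

lemma has_limit_unique:
  assumes "has_limit f z a" and "has_limit f z b"
  shows "a = b"
  using assms unfolding has_limit_def
  by (metis tendsto_unique trivial_limit_within)

definition finite_limit :: "('a::topological_space \<rightharpoonup> real) \<Rightarrow> 'a \<Rightarrow> real option" where
  "finite_limit f z =
     (if \<exists>a. has_limit f z a then Some (THE a. has_limit f z a) else None)"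

lemma finite_limit_eq_Some_iff: "finite_limit f z = Some a \<longleftrightarrow> has_limit f z a"
  unfolding finite_limit_def by (auto intro: has_limit_unique theI2 the_equality)

definition iterated_limit :: "(real \<times> real \<rightharpoonup> real) \<Rightarrow> real \<Rightarrow> real \<Rightarrow> real option" where
  "iterated_limit f x0 y0 = finite_limit (\<lambda>x. finite_limit (\<lambda>y. f (x, y)) y0) x0"

(* Polynomials in x and y are represented in R[x][y]: the outer variable is y. *)
definition poly2 :: "real poly poly \<Rightarrow> real \<Rightarrow> real \<Rightarrow> real" where
  "poly2 p x y = poly (poly p [:y:]) x"

definition quotient :: "real poly poly \<Rightarrow> real poly poly \<Rightarrow> (real \<times> real \<rightharpoonup> real)" where
  "quotient p q = (\<lambda>(x, y). if poly2 q x y = 0 then None else Some (poly2 p x y / poly2 q x y))"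

(* p/q, extended by its iterated limit wherever that is finite. Where q does not vanish the
   iterated limit is the value of p/q by continuity, so only the zeros of q need it. *)
definition rational_function :: "real poly poly \<Rightarrow> real poly poly \<Rightarrow> (real \<times> real \<rightharpoonup> real)" where
  "rational_function p q =
     (\<lambda>(x, y). if poly2 q x y \<noteq> 0 then quotient p q (x, y)
               else iterated_limit (quotient p q) x y)"

definition type_I :: "(real \<Rightarrow> real) set" where
  "type_I = {\<Phi>. \<exists>(N::nat) (\<phi> :: nat \<Rightarrow> real) (e :: nat \<Rightarrow> rat).
      (\<forall>k\<in>{1..N}. \<phi> k \<noteq> 0 \<and> 1 \<le> e k) \<and> strict_mono_on {1..N} e \<and>
      \<Phi> = (\<lambda>t. \<Sum>k=1..N. \<phi> k * \<bar>t\<bar> powr (of_rat (e k)))}"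

end

theory Submission
  imports Defs "HOL-Computational_Algebra.Polynomial_Factorial"
    "HOL-Computational_Algebra.Field_as_Ring"
begin

text \<open>
If \<open>f = p/q\<close> has a limit at a point, then \<open>q\<close> has no other zero nearby: coprime \<open>p\<close> and \<open>q\<close> have
isolated common zeros (\<open>isolated_common_zeros\<close>), and at a zero of \<open>q\<close> alone \<open>f\<close> is
unbounded (\<open>denominator_nonzero_near\<close>). So \<open>f\<close> is defined on a punctured neighbourhood,
and restricting it to a continuous curve preserves the limit.

Conversely, suppose that \<open>f\<close> stays away from \<open>a\<close> on points accumulating at the centre, which is
moved to the origin. The set \<open>q \<noteq> 0\<close>, \<open>\<bar>f - a\<bar> > \<epsilon>/2\<close> is the set \<open>F > 0\<close> for the polynomial
\<open>F = ((p - a q)\<^sup>2 - (\<epsilon>/2)\<^sup>2 q\<^sup>2) q\<^sup>2\<close>, and reflections and the exchange of the coordinates reduce the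
question to points with \<open>0 < x\<close>, \<open>\<bar>y\<bar> \<le> x\<close>. It suffices that \<open>F > 0\<close> then holds at arbitrarily
small points of a type I curve, and this is a curve selection lemma
(\<open>positive_along_curve\<close>). For such small \<open>x\<close> let \<open>z\<close> maximise \<open>F(x, _)\<close> over \<open>[-x, x]\<close>. If \<open>z = \<plusminus>x\<close>
infinitely often, a line does it. Otherwise \<open>\<partial>F/\<partial>y\<close> vanishes at \<open>(x, z)\<close>, which has two
consequences. By elimination, a nonzero value of \<open>F\<close> on the curve \<open>\<partial>F/\<partial>y = 0\<close> cannot be smaller
than a fixed power \<open>c x\<^sup>M\<close> (\<open>value_on_zero_set\<close>). By Newton's polygon, \<open>z\<close> is a branch of an
algebraic curve, so that a type I function \<open>\<Phi>\<close> approximates it with an error \<open>O(x\<^sup>M\<^sup>+\<^sup>1)\<close>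
(\<open>branch_type_I\<close>). As \<open>F\<close> is Lipschitz, \<open>F(x, \<Phi>(x)) > 0\<close>.

No convergent Puiseux expansion is constructed. The Newton algorithm runs along a sequence of
points of the curve and passes to subsequences, so that every leading coefficient is a limit of
real numbers and is automatically real.
\<close>

section \<open>Polynomials in two variables\<close>

text \<open>The order at \<open>y = 0\<close> of the slice at \<open>x = 0\<close> is the quantity that the Newton algorithm decreases.\<close>

definition slice :: "real poly poly \<Rightarrow> real \<Rightarrow> real poly" where
  "slice P x = map_poly (\<lambda>h. poly h x) P"

lemma coeff_slice [simp]: "coeff (slice P x) i = poly (coeff P i) x"
  by (simp add: slice_def coeff_map_poly)

lemma poly2_eq_sum:
  assumes "degree P \<le> d"
  shows "poly2 P x y = (\<Sum>i\<le>d. poly (coeff P i) x * y ^ i)"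
proof -
  have "poly2 P x y = (\<Sum>i\<le>degree P. poly (coeff P i) x * y ^ i)"
    by (simp add: poly2_def poly_altdef[of P] poly_sum)
  also have "\<dots> = (\<Sum>i\<le>d. poly (coeff P i) x * y ^ i)"
    using assms by (intro sum.mono_neutral_left) (auto simp: coeff_eq_0)
  finally show ?thesis .
qed

lemma degree_slice_le: "degree (slice P x) \<le> degree P"
  by (intro degree_le) (auto simp: coeff_eq_0)

lemma poly_slice: "poly (slice P x) y = poly2 P x y"
proof -
  have "poly (slice P x) y = (\<Sum>i\<le>degree P. coeff (slice P x) i * y ^ i)"
    unfolding poly_altdef using degree_slice_le[of P x]
    by (intro sum.mono_neutral_left) (auto simp del: coeff_slice simp: coeff_eq_0)
  then show ?thesis by (simp add: poly2_eq_sum[OF order.refl])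
qed

lemma poly2_simps [simp]:
  "poly2 0 x y = 0" "poly2 1 x y = 1"
  "poly2 (P + Q) x y = poly2 P x y + poly2 Q x y"
  "poly2 (P - Q) x y = poly2 P x y - poly2 Q x y"
  "poly2 (P * Q) x y = poly2 P x y * poly2 Q x y"
  "poly2 (smult h P) x y = poly h x * poly2 P x y"
  "poly2 [:h:] x y = poly h x"
  by (simp_all add: poly2_def)

lemma continuous_on_poly2: "continuous_on A (\<lambda>z. poly2 P (fst z) (snd z))"
  unfolding poly2_eq_sum[OF order.refl] by (intro continuous_intros)

lemma tendsto_poly2:
  assumes "(X \<longlongrightarrow> x) F" "(Y \<longlongrightarrow> y) F"
  shows "((\<lambda>n. poly2 P (X n) (Y n)) \<longlongrightarrow> poly2 P x y) F"
  unfolding poly2_eq_sum[OF order.refl] using assms by (intro tendsto_intros)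

text \<open>For fixed \<open>x \<in> A\<close> infinitely many zeros in \<open>y\<close> annihilate every coefficient at \<open>x\<close>; a coefficient with
infinitely many zeros is the zero polynomial.\<close>

lemma poly2_eq_0_box:
  assumes "infinite A" "infinite B" "\<And>x y. x \<in> A \<Longrightarrow> y \<in> B \<Longrightarrow> poly2 P x y = 0"
  shows "P = 0"
proof (rule ccontr)
  assume "P \<noteq> 0"
  have "poly (coeff P i) x = 0" if "x \<in> A" for x i
  proof -
    have "B \<subseteq> {y. poly (slice P x) y = 0}" using assms(3) that by (auto simp: poly_slice)
    then have "slice P x = 0"
      using assms(2) poly_roots_finite finite_subset by blast
    then show ?thesis by (metis coeff_0 coeff_slice)
  qed
  then have "A \<subseteq> {x. poly (lead_coeff P) x = 0}" by auto
  then have "lead_coeff P = 0"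
    using assms(1) poly_roots_finite finite_subset by blast
  with \<open>P \<noteq> 0\<close> show False by simp
qed

lemma nonzero_near:
  assumes "P \<noteq> 0" "d > 0"
  obtains x' y' where "\<bar>x' - x\<bar> < d" "\<bar>y' - y\<bar> < d" "x' \<noteq> x" "poly2 P x' y' \<noteq> 0"
proof -
  have "infinite {x<..<x+d}" "infinite {y<..<y+d}" using assms(2) by auto
  then obtain x' y' where "x' \<in> {x<..<x+d}" "y' \<in> {y<..<y+d}" "poly2 P x' y' \<noteq> 0"
    using poly2_eq_0_box[of "{x<..<x+d}" "{y<..<y+d}" P] assms(1) by blast
  then show ?thesis using that[of x' y'] by auto
qed

text \<open>Changes of variables (translations, reflections, blow-ups) are easier to recognise as polynomial
functions than to construct as elements of \<open>\<real>[x][y]\<close>.\<close>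

definition bipoly :: "(real \<Rightarrow> real \<Rightarrow> real) \<Rightarrow> bool" where
  "bipoly f \<longleftrightarrow> (\<exists>P. \<forall>x y. f x y = poly2 P x y)"

lemma bipoly_const: "bipoly (\<lambda>x y. c)"
  unfolding bipoly_def by (rule exI[of _ "[:[:c:]:]"]) simp

lemma bipoly_fst: "bipoly (\<lambda>x y. x)"
  unfolding bipoly_def by (rule exI[of _ "[:[:0,1:]:]"]) simp

lemma bipoly_snd: "bipoly (\<lambda>x y. y)"
  unfolding bipoly_def by (rule exI[of _ "[:0,1:]"]) (simp add: poly2_def)

lemma bipoly_add:
  assumes "bipoly f" "bipoly g" shows "bipoly (\<lambda>x y. f x y + g x y)"
  using assms unfolding bipoly_def by (metis poly2_simps(3))

lemma bipoly_diff:
  assumes "bipoly f" "bipoly g" shows "bipoly (\<lambda>x y. f x y - g x y)"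
  using assms unfolding bipoly_def by (metis poly2_simps(4))

lemma bipoly_mult:
  assumes "bipoly f" "bipoly g" shows "bipoly (\<lambda>x y. f x y * g x y)"
  using assms unfolding bipoly_def by (metis poly2_simps(5))

lemma bipoly_power:
  assumes "bipoly f" shows "bipoly (\<lambda>x y. f x y ^ n)"
  by (induction n) (use assms in \<open>auto intro: bipoly_mult bipoly_const\<close>)

lemma bipoly_sum:
  assumes "\<And>i. i \<in> I \<Longrightarrow> bipoly (f i)" shows "bipoly (\<lambda>x y. \<Sum>i\<in>I. f i x y)"
  using assms
  by (induction I rule: infinite_finite_induct) (auto intro: bipoly_const bipoly_add)

lemmas bipoly_intros = bipoly_const bipoly_fst bipoly_snd bipoly_add bipoly_diff
  bipoly_mult bipoly_power bipoly_sum

lemma bipoly_compose: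
  assumes "bipoly f" "bipoly g"
  shows "bipoly (\<lambda>x y. poly2 P (f x y) (g x y))"
  unfolding poly2_eq_sum[OF order.refl] poly_altdef
  by (intro bipoly_intros assms)

lemma poly2_pderiv:
  "((\<lambda>y. poly2 P x y) has_real_derivative poly2 (pderiv P) x y) (at y)"
proof -
  have "slice (pderiv P) x = pderiv (slice P x)"
    by (intro poly_eqI) (simp add: coeff_pderiv)
  then have "poly2 (pderiv P) x y = poly (pderiv (slice P x)) y"
    by (simp flip: poly_slice)
  then show ?thesis unfolding poly_slice[symmetric] by (simp add: poly_DERIV)
qed

lemma poly2_bounded:
  obtains C where "C > 0" "\<And>x y. \<bar>x\<bar> \<le> r \<Longrightarrow> \<bar>y\<bar> \<le> r \<Longrightarrow> \<bar>poly2 P x y\<bar> \<le> C"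
proof -
  have "compact ((\<lambda>z. poly2 P (fst z) (snd z)) ` ({-r..r} \<times> {-r..r}))"
    by (intro compact_continuous_image continuous_on_poly2 compact_Times) auto
  then have "bounded ((\<lambda>z. poly2 P (fst z) (snd z)) ` ({-r..r} \<times> {-r..r}))"
    by (rule compact_imp_bounded)
  then obtain C where "C > 0"
    and C: "\<forall>w\<in>(\<lambda>z. poly2 P (fst z) (snd z)) ` ({-r..r} \<times> {-r..r}). norm w \<le> C"
    by (auto simp: bounded_pos)
  then have "\<bar>poly2 P x y\<bar> \<le> C" if "\<bar>x\<bar> \<le> r" "\<bar>y\<bar> \<le> r" for x y
  proof -
    have "(x, y) \<in> {-r..r} \<times> {-r..r}" using that by (auto simp: abs_le_iff)
    from imageI[OF this, of "\<lambda>z. poly2 P (fst z) (snd z)"] show ?thesis using C by auto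
  qed
  with \<open>C > 0\<close> show ?thesis using that by blast
qed

section \<open>Elimination of the second variable\<close>

text \<open>A nonzero element \<open>h\<close> of minimal \<open>y\<close>-degree in the ideal \<open>(F, G)\<close> leaves pseudo-remainder \<open>0\<close> on
every member of the ideal, so it divides the member up to a factor in \<open>\<real>[x]\<close>. By Gauss's lemma the
primitive part of \<open>h\<close> divides the member itself. If it has degree \<open>0\<close>, then \<open>h \<in> \<real>[x]\<close>.\<close>

lemma ideal_dichotomy:
  fixes F G :: "real poly poly"
  assumes "G \<noteq> 0"
  shows "(\<exists>A B D. D \<noteq> 0 \<and> A * F + B * G = [:D:]) \<or>
         (\<exists>\<pi>. degree \<pi> > 0 \<and> \<pi> dvd F \<and> \<pi> dvd G)"
proof -
  define I where "I = {h. h \<noteq> 0 \<and> (\<exists>A B. h = A * F + B * G)}"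
  have "G = 0 * F + 1 * G" by simp
  then have "G \<in> I" unfolding I_def using assms by blast
  define h where "h = arg_min degree (\<lambda>h. h \<in> I)"
  have "h \<in> I" and hmin: "\<And>r. r \<in> I \<Longrightarrow> degree h \<le> degree r"
    using arg_min_nat_lemma[of "\<lambda>h. h \<in> I" G degree] \<open>G \<in> I\<close> by (auto simp: h_def)
  then obtain A B where h: "h \<noteq> 0" "h = A * F + B * G" by (auto simp: I_def)
  show ?thesis
  proof (cases "degree h = 0")
    case True
    then obtain D where "h = [:D:]" by (rule degree_eq_zeroE)
    then show ?thesis using h by auto
  next
    case False
    define \<pi> where "\<pi> = primitive_part h"
    have cont: "content \<pi> = 1" using h by (simp add: \<pi>_def)
    have "\<pi> dvd h" unfolding \<pi>_def by (metis content_times_primitive_part dvd_smult dvd_refl)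
    have dvd: "\<pi> dvd K" if K: "K = A' * F + B' * G" for K A' B'
    proof -
      obtain a q where aq: "a \<noteq> 0" "smult a K = h * q + pseudo_mod K h"
        and r: "pseudo_mod K h = 0 \<or> degree (pseudo_mod K h) < degree h"
        using pseudo_mod[OF h(1)] by metis
      have "pseudo_mod K h = (smult a A' - A * q) * F + (smult a B' - B * q) * G"
        using aq(2) unfolding K h(2) by (simp add: algebra_simps smult_add_right)
      then have "pseudo_mod K h = 0"
        using r hmin unfolding I_def by (metis (mono_tags, lifting) leD mem_Collect_eq)
      then have "\<pi> dvd smult a K" using aq(2) \<open>\<pi> dvd h\<close> by simp
      then have "fract_poly \<pi> dvd smult (to_fract a) (fract_poly K)"
        by (metis fract_poly_dvd fract_poly_smult)
      then have "fract_poly \<pi> dvd fract_poly K"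
        using aq(1) by (simp add: dvd_smult_iff)
      then show ?thesis using cont by (rule fract_poly_dvdD)
    qed
    have "\<pi> dvd F" using dvd[of F 1 0] by simp
    moreover have "\<pi> dvd G" using dvd[of G 0 1] by simp
    moreover have "degree \<pi> > 0" using False by (simp add: \<pi>_def)
    ultimately show ?thesis by blast
  qed
qed

lemma coprime_bezout:
  fixes p q :: "real poly poly"
  assumes "coprime p q" "q \<noteq> 0"
  obtains A B D where "D \<noteq> 0" "A * p + B * q = [:D:]"
proof -
  have "\<not> (degree \<pi> > 0 \<and> \<pi> dvd p \<and> \<pi> dvd q)" for \<pi>
    using coprime_common_divisor[OF assms(1), of \<pi>] by (auto simp: is_unit_poly_iff)
  then show ?thesis using ideal_dichotomy[OF assms(2), of p] that by blast
qed

text \<open>On \<open>G = 0\<close> an identity \<open>A F + B G = D(x)\<close> turns into \<open>A F = D(x)\<close>, and \<open>A\<close> is bounded. A common factor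
\<open>\<pi>\<close> of \<open>F\<close> and \<open>G\<close> can be cancelled from \<open>G\<close>, because \<open>F\<close> vanishes where \<open>\<pi>\<close> does.\<close>

lemma value_on_zero_set:
  fixes F G :: "real poly poly"
  assumes "G \<noteq> 0"
  shows "\<exists>D C. D \<noteq> 0 \<and> C > 0 \<and> (\<forall>x y. \<bar>x\<bar> \<le> 1 \<longrightarrow> \<bar>y\<bar> \<le> 1 \<longrightarrow> poly2 G x y = 0 \<longrightarrow>
           poly2 F x y = 0 \<or> C * \<bar>poly D x\<bar> \<le> \<bar>poly2 F x y\<bar>)"
  using assms
proof (induction "degree G" arbitrary: G rule: less_induct)
  case less
  show ?case
  proof (cases "\<exists>A B D. D \<noteq> 0 \<and> A * F + B * G = [:D:]")
    case True
    then obtain A B D where D: "D \<noteq> 0" "A * F + B * G = [:D:]" by blast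
    obtain K where K: "K > 0" "\<And>x y. \<bar>x\<bar> \<le> 1 \<Longrightarrow> \<bar>y\<bar> \<le> 1 \<Longrightarrow> \<bar>poly2 A x y\<bar> \<le> K"
      using poly2_bounded[of 1 A] by blast
    have "(1 / K) * \<bar>poly D x\<bar> \<le> \<bar>poly2 F x y\<bar>"
      if "\<bar>x\<bar> \<le> 1" "\<bar>y\<bar> \<le> 1" "poly2 G x y = 0" for x y
    proof -
      have "poly D x = poly2 A x y * poly2 F x y"
        using arg_cong[OF D(2), of "\<lambda>P. poly2 P x y"] that by simp
      then have "\<bar>poly D x\<bar> \<le> K * \<bar>poly2 F x y\<bar>"
        using K(2)[OF that(1,2)] by (simp add: abs_mult mult_right_mono)
      then show ?thesis using K(1) by (simp add: field_simps)
    qed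
    then show ?thesis using D(1) K(1) by (intro exI[of _ D] exI[of _ "1/K"]) auto
  next
    case False
    then obtain \<pi> where \<pi>: "degree \<pi> > 0" "\<pi> dvd F" "\<pi> dvd G"
      using ideal_dichotomy[OF less.prems, of F] by blast
    then obtain F' G' where F': "F = \<pi> * F'" and G': "G = \<pi> * G'" by (auto elim!: dvdE)
    then have "G' \<noteq> 0" "degree G' < degree G"
      using less.prems \<pi>(1) by (auto simp: degree_mult_eq)
    then obtain D C where DC: "D \<noteq> 0" "C > 0"
      "\<forall>x y. \<bar>x\<bar> \<le> 1 \<longrightarrow> \<bar>y\<bar> \<le> 1 \<longrightarrow> poly2 G' x y = 0 \<longrightarrow>
           poly2 F x y = 0 \<or> C * \<bar>poly D x\<bar> \<le> \<bar>poly2 F x y\<bar>"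
      using less.hyps by blast
    then show ?thesis by (intro exI[of _ D] exI[of _ C]) (auto simp: G' F')
  qed
qed

section \<open>Polynomials with rational exponents\<close>

text \<open>Finite sums \<open>\<Sum> c t\<^sup>r\<close> with rational exponents \<open>r \<ge> l\<close>. Exponents may repeat and come in any order,
as the Newton algorithm adds one monomial at a time in front of a rescaled sum.\<close>

inductive_set genpoly :: "rat \<Rightarrow> (real \<Rightarrow> real) set" for l :: rat where
  zero: "(\<lambda>t. 0) \<in> genpoly l"
| add: "l \<le> r \<Longrightarrow> f \<in> genpoly l \<Longrightarrow> (\<lambda>t. c * t powr of_rat r + f t) \<in> genpoly l"

lemma genpoly_shift:
  assumes "f \<in> genpoly 0" "b \<ge> 0"
  shows "\<exists>g\<in>genpoly a. \<forall>t>0. g t = t powr of_rat a * f (t powr of_rat b)"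
  using assms(1)
proof induction
  case zero
  show ?case by (rule bexI[OF _ genpoly.zero]) simp
next
  case (add r f c)
  then obtain g where g: "g \<in> genpoly a" "\<forall>t>0. g t = t powr of_rat a * f (t powr of_rat b)"
    by blast
  have "a \<le> a + b * r" using add.hyps(1) assms(2) by simp
  then have "(\<lambda>t. c * t powr of_rat (a + b * r) + g t) \<in> genpoly a"
    using g(1) by (rule genpoly.add)
  moreover have "\<forall>t>0. c * t powr of_rat (a + b * r) + g t =
      t powr of_rat a * (c * (t powr of_rat b) powr of_rat r + f (t powr of_rat b))"
  proof (intro allI impI)
    fix t :: real assume "t > 0"
    then have gt: "g t = t powr of_rat a * f (t powr of_rat b)" using g(2) by blast
    have "t powr of_rat (a + b * r) = t powr of_rat a * (t powr of_rat b) powr of_rat r"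
      by (simp only: powr_powr powr_add of_rat_add of_rat_mult)
    then show "c * t powr of_rat (a + b * r) + g t =
      t powr of_rat a * (c * (t powr of_rat b) powr of_rat r + f (t powr of_rat b))"
      unfolding gt by (simp only: distrib_left mult.left_commute)
  qed
  ultimately show ?case
    by (intro bexI[where x = "\<lambda>t. c * t powr of_rat (a + b * r) + g t"]) 
qed

lemma genpoly_as_sum:
  assumes "f \<in> genpoly l"
  shows "\<exists>S c. finite S \<and> S \<subseteq> {l..} \<and> (\<forall>t. f t = (\<Sum>r\<in>S. c r * t powr of_rat r))"
  using assms
proof induction
  case zero
  show ?case by (rule exI[of _ "{}"]) auto
next
  case (add r f c)
  then obtain S d where S: "finite S" "S \<subseteq> {l..}" "\<And>t. f t = (\<Sum>r\<in>S. d r * t powr of_rat r)"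
    by blast
  define d' where "d' = (\<lambda>s. (if s = r then c else 0) + (if s \<in> S then d s else 0))"
  have "c * t powr of_rat r + f t = (\<Sum>s\<in>insert r S. d' s * t powr of_rat s)" for t
  proof -
    have "(\<Sum>s\<in>insert r S. d' s * t powr of_rat s) =
        (\<Sum>s\<in>insert r S. (if s = r then c * t powr of_rat s else 0)) +
        (\<Sum>s\<in>insert r S. (if s \<in> S then d s * t powr of_rat s else 0))"
      unfolding d'_def sum.distrib[symmetric] by (intro sum.cong) (auto simp: algebra_simps)
    also have "(\<Sum>s\<in>insert r S. (if s = r then c * t powr of_rat s else 0)) = c * t powr of_rat r"
      using S(1) by simp
    also have "(\<Sum>s\<in>insert r S. (if s \<in> S then d s * t powr of_rat s else 0)) = f t"
      unfolding S(3) using S(1) by (intro sum.mono_neutral_cong_right) auto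
    finally show ?thesis by simp
  qed
  then show ?case using S add.hyps
    by (intro exI[of _ "insert r S"] exI[of _ d']) auto
qed

text \<open>The normal form required of type I functions is reached by dropping zero coefficients and
enumerating the finite set of exponents in increasing order.\<close>

lemma genpoly_type_I:
  assumes "f \<in> genpoly 1"
  shows "(\<lambda>t. f \<bar>t\<bar>) \<in> type_I"
proof -
  obtain S' c where S': "finite S'" "S' \<subseteq> {1..}"
    "\<And>t. f t = (\<Sum>r\<in>S'. c r * t powr of_rat r)"
    using genpoly_as_sum[OF assms] by blast
  define S where "S = {r\<in>S'. c r \<noteq> 0}"
  have S: "finite S" "S \<subseteq> {1..}" using S' by (auto simp: S_def)
  have f: "f t = (\<Sum>r\<in>S. c r * t powr of_rat r)" for t
    unfolding S'(3) S_def using S'(1) by (intro sum.mono_neutral_right) auto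
  define xs where "xs = sorted_list_of_set S"
  define e where "e = (\<lambda>k. xs ! (k - 1))"
  have xs: "set xs = S" "length xs = card S" "sorted_wrt (<) xs"
    using S(1) by (simp_all add: xs_def)
  have mono: "strict_mono_on {1..card S} e"
  proof (rule strict_mono_onI)
    fix r s assume "r \<in> {1..card S}" "s \<in> {1..card S}" "r < s"
    then have "r - 1 < s - 1" "s - 1 < length xs" unfolding xs(2) by auto
    then show "e r < e s" unfolding e_def by (rule sorted_wrt_nth_less[OF xs(3)])
  qed
  have img: "e ` {1..card S} = S"
  proof -
    have "e ` {1..card S} = (!) xs ` {..<card S}"
      unfolding image_Suc_lessThan[symmetric] image_image by (simp add: e_def)
    also have "\<dots> = set xs"
      using xs(2) by (auto simp: set_conv_nth image_iff)
    finally show ?thesis using xs(1) by simp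
  qed
  have "bij_betw e {1..card S} S"
    unfolding bij_betw_def using img strict_mono_on_imp_inj_on[OF mono] by blast
  then have "f \<bar>t\<bar> = (\<Sum>k=1..card S. c (e k) * \<bar>t\<bar> powr of_rat (e k))" for t
    unfolding f by (rule sum.reindex_bij_betw[symmetric])
  moreover have "\<forall>k\<in>{1..card S}. c (e k) \<noteq> 0 \<and> 1 \<le> e k"
    using img S(2) S_def by auto
  ultimately show ?thesis using mono unfolding type_I_def
    by (intro CollectI exI[of _ "card S"] exI[of _ "\<lambda>k. c (e k)"] exI[of _ e]) auto
qed

lemma type_I_tendsto_0:
  assumes "\<Phi> \<in> type_I" "(g \<longlongrightarrow> 0) F"
  shows "((\<lambda>n. \<Phi> (g n)) \<longlongrightarrow> 0) F"
proof -
  obtain N \<phi> e where e: "\<forall>k\<in>{1..N::nat}. \<phi> k \<noteq> 0 \<and> (1::rat) \<le> e k"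
    and \<Phi>: "\<Phi> = (\<lambda>t. \<Sum>k=1..N. \<phi> k * \<bar>t\<bar> powr (of_rat (e k)))"
    using assms(1) by (auto simp: type_I_def)
  have "((\<lambda>n. \<Sum>k=1..N. \<phi> k * \<bar>g n\<bar> powr (of_rat (e k))) \<longlongrightarrow> (\<Sum>k=1..N. \<phi> k * 0)) F"
  proof (intro tendsto_sum tendsto_mult tendsto_const)
    fix k assume "k \<in> {1..N}"
    then have "0 < (of_rat (e k) :: real)" using e by force
    moreover have "((\<lambda>n. \<bar>g n\<bar>) \<longlongrightarrow> 0) F" using assms(2) by (rule tendsto_rabs_zero)
    ultimately show "((\<lambda>n. \<bar>g n\<bar> powr of_rat (e k)) \<longlongrightarrow> 0) F"
      by (intro tendsto_zero_powrI[OF _ tendsto_const always_eventually]) simp_all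
  qed
  then show ?thesis by (simp add: \<Phi>)
qed

lemma type_I_minus: "\<Phi> \<in> type_I \<Longrightarrow> \<Phi> (- t) = \<Phi> t"
  by (auto simp: type_I_def)

section \<open>The Newton polygon\<close>

lemma coeff_below_order:
  fixes P :: "real poly"
  assumes "P \<noteq> 0"
  shows "i < order 0 P \<Longrightarrow> coeff P i = 0" "coeff P (order 0 P) \<noteq> 0"
proof -
  show *: "i < order 0 P \<Longrightarrow> coeff P i = 0" for i
    using monom_1_dvd_iff[OF assms, of "order 0 P"] by (auto simp: monom_1_dvd_iff')
  have "\<not> monom 1 (Suc (order 0 P)) dvd P"
    using monom_1_dvd_iff[OF assms] by simp
  then show "coeff P (order 0 P) \<noteq> 0"
    unfolding monom_1_dvd_iff' using * less_Suc_eq by metis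
qed

text \<open>If \<open>h\<^sub>m(0) \<noteq> 0\<close>, the terms of degree at least \<open>m\<close> behave like the single term
\<open>h\<^sub>m(0) v\<^sup>m\<close> near the origin.\<close>

lemma upper_part:
  assumes H: "\<And>n. poly2 H (t n) (v n) = 0" and lim: "t \<longlonglongrightarrow> 0" "v \<longlonglongrightarrow> 0"
    and m: "poly (coeff H m) 0 \<noteq> 0"
  obtains g where "g \<longlonglongrightarrow> poly (coeff H m) 0"
    "\<And>n. (\<Sum>i<m. poly (coeff H i) (t n) * v n ^ i) + v n ^ m * g n = 0"
proof -
  define g where "g = (\<lambda>n. \<Sum>i\<in>{m..degree H}. poly (coeff H i) (t n) * v n ^ (i - m))"
  have md: "m \<le> degree H" using m by (metis coeff_eq_0 not_le poly_0)
  have "g \<longlonglongrightarrow> (\<Sum>i\<in>{m..degree H}. poly (coeff H i) 0 * 0 ^ (i - m))"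
    unfolding g_def using lim by (intro tendsto_intros)
  also have "(\<Sum>i\<in>{m..degree H}. poly (coeff H i) 0 * 0 ^ (i - m)) =
      (\<Sum>i\<in>{m}. poly (coeff H i) 0 * 0 ^ (i - m))"
    using md by (intro sum.mono_neutral_right) auto
  finally have "g \<longlonglongrightarrow> poly (coeff H m) 0" by simp
  moreover have "(\<Sum>i<m. poly (coeff H i) (t n) * v n ^ i) + v n ^ m * g n = 0" for n
  proof -
    have "0 = (\<Sum>i\<le>degree H. poly (coeff H i) (t n) * v n ^ i)"
      using H[of n] poly2_eq_sum[OF order.refl, of H "t n" "v n"] by simp
    also have "{..degree H} = {..<m} \<union> {m..degree H}" using md by auto
    also have "(\<Sum>i\<in>{..<m} \<union> {m..degree H}. poly (coeff H i) (t n) * v n ^ i) =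
        (\<Sum>i<m. poly (coeff H i) (t n) * v n ^ i) +
        (\<Sum>i\<in>{m..degree H}. poly (coeff H i) (t n) * v n ^ i)"
      by (intro sum.union_disjoint) auto
    also have "(\<Sum>i\<in>{m..degree H}. poly (coeff H i) (t n) * v n ^ i) = v n ^ m * g n"
      unfolding g_def sum_distrib_left
      by (intro sum.cong) (auto simp flip: power_add)
    finally show ?thesis by simp
  qed
  ultimately show ?thesis using that by blast
qed

text \<open>With \<open>w i\<close> the order at \<open>0\<close> of the \<open>i\<close>-th coefficient, the lower edge of the polygon that ends at
\<open>(m, 0)\<close> has the slope \<open>min w i / (m - i)\<close>. The index \<open>m - 1\<close> is preferred when it lies on the edge:
then the slope is an integer and no root of \<open>x\<close> has to be extracted.\<close>

lemma newton_edge: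
  fixes w :: "nat \<Rightarrow> nat"
  assumes "I \<noteq> {}" "I \<subseteq> {..<m}"
  obtains i0 where "i0 \<in> I" "\<And>i. i \<in> I \<Longrightarrow> w i0 * (m - i) \<le> (m - i0) * w i"
    "m - i0 \<noteq> 1 \<Longrightarrow> m - 1 \<in> I \<Longrightarrow> w i0 < (m - i0) * w (m - 1)"
proof -
  have fin: "finite I" using assms(2) finite_subset by blast
  define \<rho> where "\<rho> = (\<lambda>i. real (w i) / real (m - i))"
  obtain i1 where i1: "i1 \<in> I" "\<And>i. i \<in> I \<Longrightarrow> \<rho> i1 \<le> \<rho> i"
    using arg_min_if_finite(1)[OF fin assms(1), of \<rho>] arg_min_least[OF fin assms(1), of _ \<rho>] by blast
  have frac: "x / p \<le> y / q \<longleftrightarrow> x * q \<le> y * p" if "p > 0" "q > 0" for x y p q :: real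
    using that by (simp only: pos_divide_le_eq times_divide_eq_left pos_le_divide_eq)
  have cross: "\<rho> i \<le> \<rho> j \<longleftrightarrow> w i * (m - j) \<le> (m - i) * w j" if "i \<in> I" "j \<in> I" for i j
  proof -
    have "i < m" "j < m" using that assms(2) by auto
    then have "\<rho> i \<le> \<rho> j \<longleftrightarrow> real (w i) * real (m - j) \<le> real (w j) * real (m - i)"
      using frac[of "real (m - i)" "real (m - j)" "real (w i)" "real (w j)"] by (simp add: \<rho>_def)
    also have "\<dots> \<longleftrightarrow> w i * (m - j) \<le> w j * (m - i)"
      by (simp only: of_nat_mult[symmetric] of_nat_le_iff)
    finally show ?thesis by (simp add: mult.commute)
  qed
  show ?thesis
  proof (cases "m - 1 \<in> I \<and> \<rho> (m - 1) \<le> \<rho> i1")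
    case True
    then have "\<rho> (m - 1) \<le> \<rho> i" if "i \<in> I" for i using i1(2)[OF that] by simp
    moreover have "m - (m - 1) = 1" using True assms(2) by auto
    ultimately show ?thesis using that[of "m - 1"] True cross by simp
  next
    case False
    have "w i1 < (m - i1) * w (m - 1)" if "m - 1 \<in> I"
    proof -
      have "\<not> w (m - 1) * (m - i1) \<le> (m - (m - 1)) * w i1"
        using False that cross i1(1) by blast
      moreover have "m - (m - 1) = 1" using that assms(2) by auto
      ultimately show ?thesis by (simp add: mult.commute)
    qed
    then show ?thesis using that[of i1] i1 cross by simp
  qed
qed

lemma genpoly_mono:
  assumes "f \<in> genpoly l" "l' \<le> l"
  shows "f \<in> genpoly l'"
  using assms(1)
proof induction
  case zero
  show ?case by (rule genpoly.zero)
next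
  case (add r f c)
  show ?case by (rule genpoly.add) (use add assms(2) in auto)
qed

text \<open>The substitution \<open>x = s\<^sup>b\<close>, \<open>y = s\<^sup>a u\<close> along the edge of slope \<open>a / b\<close> makes all terms
divisible by \<open>s\<^sup>a\<^sup>m\<close>. At \<open>s = 0\<close> exactly the terms on the edge survive; there are at least two of
them. If \<open>b \<noteq> 1\<close>, the choice of the edge point shows that \<open>m - 1\<close> is not on the edge.\<close>

lemma newton_blow_up:
  fixes H :: "real poly poly"
  assumes H0: "slice H 0 \<noteq> 0" and m: "m = order 0 (slice H 0)"
    and low: "\<exists>i<m. coeff H i \<noteq> 0"
  obtains a b :: nat and K where "a \<ge> 1" "b \<ge> 1"
    "\<And>s u. poly2 H (s ^ b) (s ^ a * u) = s ^ (a * m) * poly2 K s u"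
    "\<And>i s. poly (coeff H i) (s ^ b) * s ^ (a * i) = s ^ (a * m) * poly (coeff K i) s"
    "coeff (slice K 0) m \<noteq> 0" "degree (slice K 0) = m"
    "\<exists>i<m. coeff (slice K 0) i \<noteq> 0"
    "b \<noteq> 1 \<Longrightarrow> coeff (slice K 0) (m - 1) = 0"
proof -
  define o' where "o' = (\<lambda>i. order 0 (coeff H i))"
  define I where "I = {i. i < m \<and> coeff H i \<noteq> 0}"
  have I: "I \<noteq> {}" "I \<subseteq> {..<m}" using low by (auto simp: I_def)
  obtain i0 where i0: "i0 \<in> I" "\<And>i. i \<in> I \<Longrightarrow> o' i0 * (m - i) \<le> (m - i0) * o' i"
    "m - i0 \<noteq> 1 \<Longrightarrow> m - 1 \<in> I \<Longrightarrow> o' i0 < (m - i0) * o' (m - 1)"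
    using newton_edge[OF I, of o'] by blast
  define a b where "a = o' i0" and "b = m - i0"
  have i0m: "i0 < m" using i0(1) by (simp add: I_def)
  have "b \<ge> 1" using i0m by (simp add: b_def)
  have "poly (coeff H i0) 0 = 0"
    using coeff_below_order(1)[OF H0, of i0] i0m m by simp
  then have "a \<ge> 1"
    using i0(1) unfolding a_def o'_def I_def by (simp add: order_root Suc_le_eq)
  have hm: "poly (coeff H m) 0 \<noteq> 0"
    using coeff_below_order(2)[OF H0] m by simp
  have "\<exists>k. (\<forall>s. poly (coeff H i) (s ^ b) * s ^ (a * i) = s ^ (a * m) * poly k s) \<and>
      (i = m \<longrightarrow> poly k 0 \<noteq> 0) \<and> (i > m \<longrightarrow> poly k 0 = 0) \<and> (i = i0 \<longrightarrow> poly k 0 \<noteq> 0) \<and>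
      (b \<noteq> 1 \<and> i = m - 1 \<longrightarrow> poly k 0 = 0) \<and> (coeff H i = 0 \<longrightarrow> k = 0)" for i
  proof (cases "i < m")
    case False
    have eq: "a * i = a * m + a * (i - m)" using False by (simp flip: distrib_left)
    define k where "k = monom 1 (a * (i - m)) * pcompose (coeff H i) (monom 1 b)"
    have pk: "poly k s = s ^ (a * (i - m)) * poly (coeff H i) (s ^ b)" for s
      by (simp add: k_def poly_pcompose poly_monom)
    then have "poly k 0 = 0" if "i > m" using that \<open>a \<ge> 1\<close> by simp
    moreover have "poly k 0 \<noteq> 0" if "i = m" using that pk hm \<open>b \<ge> 1\<close> by (simp add: zero_power)
    moreover have "poly (coeff H i) (s ^ b) * s ^ (a * i) = s ^ (a * m) * poly k s" for s
      unfolding pk eq by (simp add: power_add)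
    ultimately show ?thesis using False i0m by (intro exI[of _ k]) (auto simp: k_def)
  next
    case True
    show ?thesis
    proof (cases "coeff H i = 0")
      case True
      then show ?thesis using \<open>i < m\<close> i0(1) by (intro exI[of _ 0]) (auto simp: I_def)
    next
      case False
      then have "i \<in> I" using True by (simp add: I_def)
      obtain g where g: "coeff H i = [:- 0, 1:] ^ o' i * g" "\<not> [:- 0, 1:] dvd g"
        using order_decomp[OF False, of 0] unfolding o'_def by blast
      have g0: "poly g 0 \<noteq> 0" using g(2) by (simp add: poly_eq_0_iff_dvd)
      have hi: "poly (coeff H i) x = x ^ o' i * poly g x" for x
        by (simp add: g(1) poly_power)
      define e where "e = b * o' i - a * (m - i)"
      have le: "a * (m - i) \<le> b * o' i" using i0(2)[OF \<open>i \<in> I\<close>] by (simp add: a_def b_def)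
      have "a * m = a * (m - i) + a * i" using True by (simp flip: distrib_left)
      then have eq: "b * o' i + a * i = a * m + e" using le by (simp add: e_def)
      define k where "k = monom 1 e * pcompose g (monom 1 b)"
      have pk: "poly k s = s ^ e * poly g (s ^ b)" for s
        by (simp add: k_def poly_pcompose poly_monom)
      have "poly (coeff H i) (s ^ b) * s ^ (a * i) = s ^ (a * m) * poly k s" for s
      proof -
        have "poly (coeff H i) (s ^ b) * s ^ (a * i) = s ^ (b * o' i + a * i) * poly g (s ^ b)"
          by (simp add: hi power_add power_mult mult_ac)
        then show ?thesis by (simp add: eq pk power_add)
      qed
      moreover have "poly k 0 \<noteq> 0" if "i = i0"
      proof -
        have "e = 0" using that by (simp add: e_def a_def b_def mult.commute)
        then show ?thesis using pk g0 \<open>b \<ge> 1\<close> by (simp add: zero_power)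
      qed
      moreover have "poly k 0 = 0" if "b \<noteq> 1" "i = m - 1"
      proof -
        have "m - i = 1" using that True by simp
        then have "e > 0" using i0(3) that \<open>i \<in> I\<close> by (simp add: e_def a_def b_def)
        then show ?thesis using pk by simp
      qed
      ultimately show ?thesis using True False by (intro exI[of _ k]) auto
    qed
  qed
  then obtain k where k: "\<And>i s. poly (coeff H i) (s ^ b) * s ^ (a * i) = s ^ (a * m) * poly (k i) s"
     "poly (k m) 0 \<noteq> 0" "\<And>i. i > m \<Longrightarrow> poly (k i) 0 = 0" "poly (k i0) 0 \<noteq> 0"
     "b \<noteq> 1 \<Longrightarrow> poly (k (m - 1)) 0 = 0" "\<And>i. coeff H i = 0 \<Longrightarrow> k i = 0"
    by metis
  define K where "K = (\<Sum>i\<le>degree H. monom (k i) i)"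
  have K: "coeff K i = k i" for i
    using k(6)[of i] coeff_eq_0[of H i] by (auto simp: K_def coeff_sum not_le)
  then have "degree K \<le> degree H"
    using k(6) by (intro degree_le) (auto simp: coeff_eq_0)
  have "poly2 H (s ^ b) (s ^ a * u) = s ^ (a * m) * poly2 K s u" for s u
  proof -
    have "poly2 H (s ^ b) (s ^ a * u) =
        (\<Sum>i\<le>degree H. poly (coeff H i) (s ^ b) * s ^ (a * i) * u ^ i)"
      by (simp add: poly2_eq_sum[OF order.refl] power_mult_distrib mult_ac flip: power_mult)
    also have "\<dots> = (\<Sum>i\<le>degree H. s ^ (a * m) * poly (k i) s * u ^ i)" by (simp only: k(1))
    finally show ?thesis
      using poly2_eq_sum[OF \<open>degree K \<le> degree H\<close>, of s u]
      by (simp add: K sum_distrib_left mult_ac)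
  qed
  moreover have "degree (slice K 0) = m"
    using k(2,3) K by (intro antisym degree_le le_degree) auto
  moreover have "\<exists>i<m. coeff (slice K 0) i \<noteq> 0" using k(4) K i0m by auto
  moreover have "coeff (slice K 0) m \<noteq> 0" "b \<noteq> 1 \<Longrightarrow> coeff (slice K 0) (m - 1) = 0"
    using k(2,5) K by simp_all
  moreover have "poly (coeff H i) (s ^ b) * s ^ (a * i) = s ^ (a * m) * poly (coeff K i) s" for i s
    using k(1) K by simp
  ultimately show ?thesis using that \<open>a \<ge> 1\<close> \<open>b \<ge> 1\<close> by blast
qed

text \<open>For \<open>\<bar>u\<bar> > 1\<close> the term of degree \<open>m\<close> has to be balanced by terms of degree at most \<open>m - 1\<close> with bounded
coefficients. The terms of degree above \<open>m\<close> are harmless because \<open>v = s\<^sup>a u\<close> tends to \<open>0\<close>.\<close>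

lemma scaled_root_bounded:
  assumes hom: "\<And>s u. poly2 H (s ^ b) (s ^ a * u) = s ^ (a * m) * poly2 K s u"
    and t: "\<And>n. s n > 0" "s \<longlonglongrightarrow> 0" and b: "b \<ge> 1" and v: "(\<lambda>n. s n ^ a * u n) \<longlonglongrightarrow> 0"
    and zero: "\<And>n. poly2 K (s n) (u n) = 0"
    and m: "poly (coeff H m) 0 \<noteq> 0"
    and coeffs: "\<And>i x. poly (coeff H i) (x ^ b) * x ^ (a * i) = x ^ (a * m) * poly (coeff K i) x"
  shows "Bseq u"
proof -
  have z: "poly2 H (s n ^ b) (s n ^ a * u n) = 0" for n
    by (simp add: hom zero)
  have sb: "(\<lambda>n. s n ^ b) \<longlonglongrightarrow> 0"
    using tendsto_power[OF t(2), of b] b by (simp add: zero_power)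
  obtain g where g: "g \<longlonglongrightarrow> poly (coeff H m) 0"
    "\<And>n. (\<Sum>i<m. poly (coeff H i) (s n ^ b) * (s n ^ a * u n) ^ i) + (s n ^ a * u n) ^ m * g n = 0"
    by (rule upper_part[OF z sb v m]) (rule that)
  have eq: "(\<Sum>i<m. poly (coeff K i) (s n) * u n ^ i) + u n ^ m * g n = 0" for n
  proof -
    have "s n ^ (a * m) * ((\<Sum>i<m. poly (coeff K i) (s n) * u n ^ i) + u n ^ m * g n) =
      (\<Sum>i<m. (s n ^ (a * m) * poly (coeff K i) (s n)) * u n ^ i) + s n ^ (a * m) * u n ^ m * g n"
      by (simp add: distrib_left sum_distrib_left mult_ac)
    also have "\<dots> = 0"
      using g(2)[of n] unfolding coeffs[symmetric]
      by (simp add: power_mult_distrib mult_ac flip: power_mult)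
    finally show ?thesis using t(1)[of n] by simp
  qed
  define \<eta> where "\<eta> = \<bar>poly (coeff H m) 0\<bar> / 2"
  have "\<eta> > 0" using m by (simp add: \<eta>_def)
  have ev1: "eventually (\<lambda>n. \<bar>g n\<bar> > \<eta>) sequentially"
    using tendsto_rabs[OF g(1)] m by (intro order_tendstoD) (auto simp: \<eta>_def)
  define B where "B = (\<lambda>x. \<Sum>i<m. \<bar>poly (coeff K i) x\<bar>)"
  have "(\<lambda>n. B (s n)) \<longlonglongrightarrow> B 0"
    unfolding B_def by (intro tendsto_intros t(2))
  then have ev2: "eventually (\<lambda>n. B (s n) < B 0 + 1) sequentially"
    by (intro order_tendstoD(2)) auto
  have "eventually (\<lambda>n. norm (u n) \<le> max 1 ((B 0 + 1) / \<eta>)) sequentially"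
    using ev1 ev2
  proof eventually_elim
    case (elim n)
    show ?case
    proof (cases "\<bar>u n\<bar> \<le> 1")
      case False
      show ?thesis
      proof (cases m)
        case 0
        then show ?thesis using eq[of n] elim \<open>\<eta> > 0\<close> by simp
      next
        case (Suc k)
        have "\<bar>u n\<bar> ^ m * \<bar>g n\<bar> = \<bar>\<Sum>i<m. poly (coeff K i) (s n) * u n ^ i\<bar>"
          using eq[of n] by (simp add: add_eq_0_iff flip: power_abs abs_mult)
        also have "\<dots> \<le> (\<Sum>i<m. \<bar>poly (coeff K i) (s n)\<bar> * \<bar>u n\<bar> ^ k)"
          using False Suc
          by (intro sum_abs[THEN order_trans] sum_mono)
             (auto simp: abs_mult power_abs intro!: mult_left_mono power_increasing)
        also have "\<dots> = B (s n) * \<bar>u n\<bar> ^ k" by (simp add: B_def sum_distrib_right)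
        also have "\<dots> \<le> (B 0 + 1) * \<bar>u n\<bar> ^ k" using elim by (intro mult_right_mono) auto
        finally have "\<bar>u n\<bar> ^ k * (\<bar>u n\<bar> * \<bar>g n\<bar>) \<le> \<bar>u n\<bar> ^ k * (B 0 + 1)"
          by (simp add: Suc mult_ac)
        then have "\<bar>u n\<bar> * \<bar>g n\<bar> \<le> B 0 + 1"
          using False by (subst (asm) mult_le_cancel_left_pos) auto
        moreover have "\<bar>u n\<bar> * \<eta> \<le> \<bar>u n\<bar> * \<bar>g n\<bar>" using elim by (intro mult_left_mono) auto
        ultimately have "\<bar>u n\<bar> \<le> (B 0 + 1) / \<eta>" using \<open>\<eta> > 0\<close> by (simp add: field_simps)
        then show ?thesis by simp
      qed
    qed simp
  qed
  then show ?thesis by (rule BfunI)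
qed

text \<open>A polynomial of degree \<open>m\<close> with an \<open>m\<close>-fold root \<open>c\<close> is \<open>\<alpha> (u - c)\<^sup>m\<close>. Its coefficient
\<open>- \<alpha> m c\<close> of degree \<open>m - 1\<close> vanishes only for \<open>c = 0\<close>, and then it is a monomial.\<close>

lemma mult_drops:
  fixes P :: "real poly"
  assumes deg: "degree P = m" and top: "coeff P m \<noteq> 0" and low: "\<exists>i<m. coeff P i \<noteq> 0"
    and zero: "coeff P (m - 1) = 0" and Q: "\<And>w. poly Q w = poly P (c + w)"
  shows "order 0 Q < m"
proof -
  have Qc: "Q = pcompose P [:c, 1:]"
    by (rule poly_eq_poly_eq_iff[THEN iffD1]) (auto simp: Q poly_pcompose)
  then have degQ: "degree Q = m" by (simp add: deg degree_pcompose)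
  have Q0: "Q \<noteq> 0"
    using low degQ by (metis Qc deg degree_0 less_nat_zero_code)
  have "order 0 Q \<le> m" using order_degree[OF Q0, of 0] degQ by simp
  moreover have "order 0 Q \<noteq> m"
  proof
    assume ord: "order 0 Q = m"
    define \<alpha> where "\<alpha> = coeff Q m"
    have "Q = monom \<alpha> m"
      using coeff_below_order(1)[OF Q0] ord degQ
      by (intro poly_eqI) (auto simp: \<alpha>_def not_less_iff_gr_or_eq coeff_eq_0 linorder_neq_iff)
    then have "poly P u = poly (smult \<alpha> ([:-c, 1:] ^ m)) u" for u
      using Q[of "u - c"] by (simp add: poly_monom)
    then have P: "P = smult \<alpha> ([:-c, 1:] ^ m)" by (intro poly_eq_poly_eq_iff[THEN iffD1]) auto
    have "m \<ge> 1" using low by auto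
    have "\<alpha> \<noteq> 0" using P top by auto
    have "coeff P (m - 1) = \<alpha> * (of_nat m * (- c))"
      using \<open>m \<ge> 1\<close> binomial_symmetric[of 1 m]
      by (simp add: P coeff_linear_poly_power)
    then have "c = 0" using zero \<open>\<alpha> \<noteq> 0\<close> \<open>m \<ge> 1\<close> by auto
    then have "P = monom \<alpha> m" using P by (simp add: monom_altdef)
    then show False using low by auto
  qed
  ultimately show ?thesis by simp
qed


text \<open>Each step writes \<open>v = s\<^sup>a (c + w)\<close> with \<open>t = s\<^sup>b\<close> and \<open>w \<longlonglongrightarrow> 0\<close>, where \<open>c\<close> is the limit of a subsequence of
\<open>v / s\<^sup>a\<close>. It terminates lexicographically: either the order \<open>m\<close> drops, or \<open>b = 1\<close>, no new
denominator appears, and the accuracy still required of \<open>w\<close> is smaller by \<open>a \<ge> 1\<close>. When \<open>m\<close> drops,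
the accuracy may grow to \<open>b M\<close>, as it is then counted in powers of \<open>s\<close>.\<close>

lemma newton_puiseux:
  assumes "\<And>n. 0 < t n" "\<And>n. t n \<le> 1" "t \<longlonglongrightarrow> 0" "v \<longlonglongrightarrow> 0"
    and "\<And>n. poly2 H (t n) (v n) = 0" "slice H 0 \<noteq> 0"
  shows "\<exists>\<Psi>\<in>genpoly 0. \<exists>(r :: nat \<Rightarrow> nat) C. strict_mono r \<and>
           (\<forall>n. \<bar>v (r n) - \<Psi> (t (r n))\<bar> \<le> C * t (r n) ^ M)"
  using assms
proof (induction "order 0 (slice H 0)" arbitrary: H t v M rule: less_induct)
  case (less H t v M)
  note outer = less.hyps
  define m where "m = order 0 (slice H 0)"
  have "\<And>n. 0 < t n" "\<And>n. t n \<le> 1" "t \<longlonglongrightarrow> 0" "v \<longlonglongrightarrow> 0"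
    "\<And>n. poly2 H (t n) (v n) = 0" "slice H 0 \<noteq> 0" "order 0 (slice H 0) = m"
    by (fact less.prems m_def[symmetric])+
  then show ?case
  proof (induction M arbitrary: H t v rule: less_induct)
    case (less M H t v)
    note inner = less.IH and t = less.prems(1-3) and v = less.prems(4)
      and zero = less.prems(5) and H0 = less.prems(6) and m = less.prems(7)
    have hm: "poly (coeff H m) 0 \<noteq> 0" using coeff_below_order(2)[OF H0] m by simp
    have witness: ?case if "\<Psi> \<in> genpoly 0" "strict_mono r"
      "\<And>n. \<bar>v (r n) - \<Psi> (t (r n))\<bar> \<le> C * t (r n) ^ M" for \<Psi> C and r :: "nat \<Rightarrow> nat"
      using that by blast
    show ?case
    proof (cases "M = 0")
      case True
      have "Bseq v" using v by (intro convergent_imp_Bseq convergentI)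
      then obtain C where "\<And>n. \<bar>v n\<bar> \<le> C" by (metis BseqE real_norm_def)
      then show ?thesis
        by (intro witness[of "\<lambda>_. 0" id C] genpoly.zero) (simp_all add: True strict_mono_def)
    next
      case False
      show ?thesis
      proof (cases "\<exists>i<m. coeff H i \<noteq> 0")
        case False
        \<comment> \<open>The equation reads \<open>v\<^sup>m g = 0\<close> with \<open>g \<noteq> 0\<close> for large \<open>n\<close>.\<close>
        obtain g where g: "g \<longlonglongrightarrow> poly (coeff H m) 0"
          "\<And>n. (\<Sum>i<m. poly (coeff H i) (t n) * v n ^ i) + v n ^ m * g n = 0"
          by (rule upper_part[OF zero t(3) v hm]) (rule that)
        have "eventually (\<lambda>n. g n \<noteq> 0) sequentially"
          using g(1) hm by (rule tendsto_imp_eventually_ne)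
        then obtain N where N: "\<And>n. n \<ge> N \<Longrightarrow> g n \<noteq> 0" by (auto simp: eventually_sequentially)
        have "v n = 0" if "n \<ge> N" for n
          using g(2)[of n] N[OF that] False by simp
        then show ?thesis
          by (intro witness[of "\<lambda>_. 0" "\<lambda>n. n + N" 0] genpoly.zero) (simp_all add: strict_mono_def)
      next
        case True
        obtain a b K where ab: "a \<ge> 1" "b \<ge> 1"
          and hom: "\<And>s u. poly2 H (s ^ b) (s ^ a * u) = s ^ (a * m) * poly2 K s u"
            "\<And>i s. poly (coeff H i) (s ^ b) * s ^ (a * i) = s ^ (a * m) * poly (coeff K i) s"
          and K: "coeff (slice K 0) m \<noteq> 0" "degree (slice K 0) = m"
            "\<exists>i<m. coeff (slice K 0) i \<noteq> 0"
            "b \<noteq> 1 \<Longrightarrow> coeff (slice K 0) (m - 1) = 0"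
          by (rule newton_blow_up[OF H0 m[symmetric] True]) (rule that)
        define s where "s = (\<lambda>n. root b (t n))"
        have s: "s n > 0" "s n \<le> 1" "s n ^ b = t n" for n
          using t(1,2)[of n] ab(2) by (auto simp: s_def)
        have s0: "s \<longlonglongrightarrow> 0" unfolding s_def using tendsto_real_root[OF t(3), of b] by simp
        define u where "u = (\<lambda>n. v n / s n ^ a)"
        have vu: "v n = s n ^ a * u n" for n using s(1)[of n] by (simp add: u_def)
        have Ku: "poly2 K (s n) (u n) = 0" for n
          using hom(1)[of "s n" "u n"] zero[of n] s(1)[of n] by (simp add: s(3) vu[symmetric])
        have "Bseq u"
          using scaled_root_bounded[OF hom(1) s(1) s0 ab(2) _ Ku hm hom(2)] v
          by (simp flip: vu)
        then obtain c r where r: "strict_mono r" "(u \<circ> r) \<longlonglongrightarrow> c"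
          using bounded_imp_convergent_subsequence[of u] by (auto simp: Bseq_eq_bounded)
        have sr: "(\<lambda>n. s (r n)) \<longlonglongrightarrow> 0"
          using LIMSEQ_subseq_LIMSEQ[OF s0 r(1)] by (simp add: o_def)
        obtain K' where K': "\<And>x w. poly2 K' x w = poly2 K x (c + w)"
          using bipoly_compose[OF bipoly_fst bipoly_add[OF bipoly_const bipoly_snd], of K c]
          unfolding bipoly_def by metis
        define w where "w = (\<lambda>n. u (r n) - c)"
        have sl: "poly (slice K' 0) x = poly (slice K 0) (c + x)" for x
          by (simp add: poly_slice K')
        then have slK': "slice K' 0 = pcompose (slice K 0) [:c, 1:]"
          by (intro poly_eq_poly_eq_iff[THEN iffD1]) (auto simp: poly_pcompose)
        have "slice K 0 \<noteq> 0" using K(1) by (metis coeff_0)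
        then have K'0: "slice K' 0 \<noteq> 0" by (auto simp: slK' pcompose_eq_0_iff)
        have ord_le: "order 0 (slice K' 0) \<le> m"
          using order_degree[OF K'0, of 0] K(2) by (simp add: slK' degree_pcompose)
        have seq: "\<And>n. 0 < s (r n)" "\<And>n. s (r n) \<le> 1" "(\<lambda>n. s (r n)) \<longlonglongrightarrow> 0" "w \<longlonglongrightarrow> 0"
          "\<And>n. poly2 K' (s (r n)) (w n) = 0"
          using s sr r(2) Ku by (auto simp: w_def K' o_def LIM_zero_iff)
        have "\<exists>\<Psi>\<in>genpoly 0. \<exists>(r' :: nat \<Rightarrow> nat) C M'. b * M \<le> a + M' \<and> strict_mono r' \<and>
            (\<forall>n. \<bar>w (r' n) - \<Psi> (s (r (r' n)))\<bar> \<le> C * s (r (r' n)) ^ M')"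
        proof (cases "order 0 (slice K' 0) < m")
          case True
          then have "order 0 (slice K' 0) < order 0 (slice H 0)" by (simp add: m)
          from outer[OF this[unfolded m m_def] seq K'0, of "b * M"] show ?thesis
            by (metis le_add2)
        next
          case False
          then have "order 0 (slice K' 0) = m" "b = 1"
            using ord_le mult_drops[OF K(2,1,3,4) sl] by auto
          moreover have "M - a < M" using \<open>M \<noteq> 0\<close> ab(1) by simp
          ultimately obtain \<Psi> C and r' :: "nat \<Rightarrow> nat" where "\<Psi> \<in> genpoly 0" "strict_mono r'"
            "\<And>n. \<bar>w (r' n) - \<Psi> (s (r (r' n)))\<bar> \<le> C * s (r (r' n)) ^ (M - a)"
            using inner[OF _ seq K'0, of "M - a"] by blast
          moreover have "b * M \<le> a + (M - a)" using \<open>b = 1\<close> by simp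
          ultimately show ?thesis by blast
        qed
        then obtain \<Psi> C M' and r' :: "nat \<Rightarrow> nat" where \<Psi>: "\<Psi> \<in> genpoly 0" and M': "b * M \<le> a + M'"
          and r': "strict_mono r'"
          and bound: "\<And>n. \<bar>w (r' n) - \<Psi> (s (r (r' n)))\<bar> \<le> C * s (r (r' n)) ^ M'" by blast
        have "(\<lambda>x. c * x powr of_rat 0 + \<Psi> x) \<in> genpoly 0"
          using \<Psi> by (intro genpoly.add) auto
        from genpoly_shift[OF this, of "1 / of_nat b" "of_nat a / of_nat b"]
        obtain g where g: "g \<in> genpoly (of_nat a / of_nat b)"
          "\<And>x. x > 0 \<Longrightarrow> g x = x powr of_rat (of_nat a / of_nat b) *
             (c * (x powr of_rat (1 / of_nat b)) powr of_rat 0 + \<Psi> (x powr of_rat (1 / of_nat b)))"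
          by auto
        have gt: "g (t n) = s n ^ a * (c + \<Psi> (s n))" for n
        proof -
          have sn: "t n powr (1 / real b) = s n"
            using t(1)[of n] ab(2) by (simp add: s_def root_powr_inverse)
          have "t n powr (real a / real b) = (t n powr (1 / real b)) powr real a"
            by (simp add: powr_powr)
          also have "\<dots> = s n ^ a" using s(1)[of n] by (simp add: sn powr_realpow)
          finally show ?thesis
            using g(2)[OF t(1)[of n]] s(1)[of n] sn by (simp add: of_rat_divide)
        qed
        have "\<bar>v (r (r' n)) - g (t (r (r' n)))\<bar> \<le> C * t (r (r' n)) ^ M" for n
        proof -
          let ?s = "s (r (r' n))"
          have "0 \<le> C * ?s ^ M'" using bound[of n] abs_ge_zero order_trans by blast
          moreover have "?s ^ M' > 0" using s(1) by simp
          ultimately have "C \<ge> 0" by (metis mult_neg_pos not_le)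
          have "\<bar>v (r (r' n)) - g (t (r (r' n)))\<bar> = ?s ^ a * \<bar>w (r' n) - \<Psi> ?s\<bar>"
            using s(1)[of "r (r' n)"] unfolding gt vu w_def
            by (simp add: right_diff_distrib[symmetric] abs_mult diff_diff_eq)
          also have "\<dots> \<le> ?s ^ a * (C * ?s ^ M')"
            using bound[of n] s(1)[of "r (r' n)"] by (intro mult_left_mono) auto
          also have "\<dots> = C * ?s ^ (a + M')" by (simp add: power_add)
          also have "\<dots> \<le> C * ?s ^ (b * M)"
            using \<open>C \<ge> 0\<close> s(1,2)[of "r (r' n)"] M'
            by (intro mult_left_mono power_decreasing) auto
          also have "?s ^ (b * M) = t (r (r' n)) ^ M" by (simp add: power_mult s(3))
          finally show ?thesis .
        qed
        moreover have "g \<in> genpoly 0" by (rule genpoly_mono[OF g(1)]) simp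
        moreover have "strict_mono (\<lambda>n. r (r' n))"
          using strict_mono_o[OF r(1) r'] by (simp add: o_def)
        ultimately show ?thesis by (intro witness[of g "\<lambda>n. r (r' n)" C]) auto
      qed
    qed
  qed
qed

section \<open>Selecting a type I curve\<close>

lemma split_power_of_x:
  assumes "G \<noteq> 0"
  shows "\<exists>k H. slice H 0 \<noteq> 0 \<and> (\<forall>x y. poly2 G x y = x ^ k * poly2 H x y)"
  using assms
proof (induction "degree (lead_coeff G)" arbitrary: G rule: less_induct)
  case less
  show ?case
  proof (cases "slice G 0 = 0")
    case False
    then show ?thesis by (intro exI[of _ 0] exI[of _ G]) auto
  next
    case True
    then have "poly (coeff G n) 0 = 0" for n by (metis coeff_0 coeff_slice)
    then have "[:[:0, 1:]:] dvd G" by (simp add: const_poly_dvd_iff poly_eq_0_iff_dvd)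
    then obtain G' where G': "G = [:[:0, 1:]:] * G'" by (elim dvdE)
    have G'0: "G' \<noteq> 0" using less.prems G' by auto
    have "lead_coeff G = [:0, 1:] * lead_coeff G'"
      unfolding G' lead_coeff_mult by simp
    then have "degree (lead_coeff G') < degree (lead_coeff G)"
      using G'0 by (simp add: degree_mult_eq)
    then obtain k H where "slice H 0 \<noteq> 0" "\<forall>x y. poly2 G' x y = x ^ k * poly2 H x y"
      using less.hyps G'0 by blast
    then show ?thesis
      by (intro exI[of _ "Suc k"] exI[of _ H]) (simp add: G')
  qed
qed

text \<open>The blow-up \<open>z = x u\<close> makes \<open>u\<close> bounded, so that it accumulates at some \<open>c\<close>. Multiplying the
approximation of \<open>u\<close> by \<open>x\<close> raises the exponents to at least \<open>1\<close>.\<close>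

lemma branch_type_I:
  assumes G: "G \<noteq> 0" and x: "\<And>n. 0 < x n" "\<And>n. x n \<le> 1" "x \<longlonglongrightarrow> 0"
    and z: "\<And>n. \<bar>z n\<bar> \<le> x n" "\<And>n. poly2 G (x n) (z n) = 0"
  shows "\<exists>\<Phi>\<in>type_I. \<exists>(r :: nat \<Rightarrow> nat) C. strict_mono r \<and>
           (\<forall>n. \<bar>z (r n) - \<Phi> (x (r n))\<bar> \<le> C * x (r n) ^ Suc M)"
proof -
  obtain G1 where G1: "\<And>s u. poly2 G1 s u = poly2 G s (s * u)"
    using bipoly_compose[OF bipoly_fst bipoly_mult[OF bipoly_fst bipoly_snd], of G]
    unfolding bipoly_def by metis
  have "G1 \<noteq> 0"
  proof -
    obtain x' y' where "x' \<noteq> 0" "poly2 G x' y' \<noteq> 0"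
      by (rule nonzero_near[OF G zero_less_one, of 0 0])
    then have "poly2 G1 x' (y' / x') \<noteq> 0" by (simp add: G1)
    then show ?thesis by auto
  qed
  then obtain k H where H: "slice H 0 \<noteq> 0" "\<And>s u. poly2 G1 s u = s ^ k * poly2 H s u"
    using split_power_of_x by blast
  define u where "u = (\<lambda>n. z n / x n)"
  have zu: "z n = x n * u n" for n using x(1)[of n] by (simp add: u_def)
  have Hu: "poly2 H (x n) (u n) = 0" for n
    using z(2)[of n] H(2)[of "x n" "u n"] x(1)[of n] by (simp add: G1 zu[symmetric])
  have "\<bar>u n\<bar> \<le> 1" for n using z(1)[of n] x(1)[of n] by (simp add: u_def abs_divide)
  then have "bounded (range u)" by (auto simp: bounded_iff)
  then obtain c r where r: "strict_mono r" "(u \<circ> r) \<longlonglongrightarrow> c"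
    using bounded_imp_convergent_subsequence by blast
  obtain H' where H': "\<And>s w. poly2 H' s w = poly2 H s (c + w)"
    using bipoly_compose[OF bipoly_fst bipoly_add[OF bipoly_const bipoly_snd], of H c]
    unfolding bipoly_def by metis
  have "slice H' 0 = pcompose (slice H 0) [:c, 1:]"
    by (intro poly_eq_poly_eq_iff[THEN iffD1]) (auto simp: poly_pcompose poly_slice H')
  then have H'0: "slice H' 0 \<noteq> 0" using H(1) by (auto simp: pcompose_eq_0_iff)
  define w where "w = (\<lambda>n. u (r n) - c)"
  have "(\<lambda>n. x (r n)) \<longlonglongrightarrow> 0"
    using LIMSEQ_subseq_LIMSEQ[OF x(3) r(1)] by (simp add: o_def)
  moreover have "w \<longlonglongrightarrow> 0" using r(2) by (simp add: w_def o_def LIM_zero_iff)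
  moreover have "poly2 H' (x (r n)) (w n) = 0" for n by (simp add: H' w_def Hu)
  ultimately have "\<exists>\<Psi>\<in>genpoly 0. \<exists>(r' :: nat \<Rightarrow> nat) C. strict_mono r' \<and>
           (\<forall>n. \<bar>w (r' n) - \<Psi> (x (r (r' n)))\<bar> \<le> C * x (r (r' n)) ^ M)"
    using x H'0 by (intro newton_puiseux[of "\<lambda>n. x (r n)"])
  then obtain \<Psi> C and r' :: "nat \<Rightarrow> nat" where \<Psi>: "\<Psi> \<in> genpoly 0" and r': "strict_mono r'"
    and bound: "\<And>n. \<bar>w (r' n) - \<Psi> (x (r (r' n)))\<bar> \<le> C * x (r (r' n)) ^ M" by blast
  have "(\<lambda>t. c * t powr of_rat 0 + \<Psi> t) \<in> genpoly 0"
    using \<Psi> by (intro genpoly.add) auto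
  from genpoly_shift[OF this, of 1 1] obtain g where g: "g \<in> genpoly 1"
    "\<And>t. t > 0 \<Longrightarrow> g t = t * (c + \<Psi> t)" by auto
  have "\<bar>z (r (r' n)) - g \<bar>x (r (r' n))\<bar>\<bar> \<le> C * x (r (r' n)) ^ Suc M" for n
  proof -
    let ?x = "x (r (r' n))"
    have "z (r (r' n)) - g \<bar>?x\<bar> = ?x * (w (r' n) - \<Psi> ?x)"
      using x(1)[of "r (r' n)"] by (simp add: zu g(2) w_def algebra_simps)
    then have "\<bar>z (r (r' n)) - g \<bar>?x\<bar>\<bar> = ?x * \<bar>w (r' n) - \<Psi> ?x\<bar>"
      using x(1)[of "r (r' n)"] by (simp add: abs_mult)
    also have "\<dots> \<le> ?x * (C * ?x ^ M)"
      using bound[of n] x(1)[of "r (r' n)"] by (intro mult_left_mono) auto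
    finally show ?thesis by (simp add: mult_ac)
  qed
  moreover have "strict_mono (\<lambda>n. r (r' n))"
    using strict_mono_o[OF r(1) r'] by (simp add: o_def)
  ultimately show ?thesis
    by (intro bexI[OF _ genpoly_type_I[OF g(1)]] exI[of _ "\<lambda>n. r (r' n)"] exI[of _ C]) auto
qed

lemma lower_bound_near_0:
  fixes D :: "real poly"
  assumes "D \<noteq> 0"
  obtains \<eta> M where "\<eta> > 0" "eventually (\<lambda>x. \<eta> * x ^ M \<le> \<bar>poly D x\<bar>) (at_right 0)"
proof -
  obtain g where g: "D = [:- 0, 1:] ^ order 0 D * g" "\<not> [:- 0, 1:] dvd g"
    using order_decomp[OF assms, of 0] by blast
  have g0: "poly g 0 \<noteq> 0" using g(2) by (simp add: poly_eq_0_iff_dvd)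
  define M where "M = order 0 D"
  have D: "poly D x = x ^ M * poly g x" for x
    using arg_cong[OF g(1), of "\<lambda>p. poly p x"] by (simp add: M_def poly_power)
  have "((\<lambda>x. \<bar>poly g x\<bar>) \<longlongrightarrow> \<bar>poly g 0\<bar>) (at_right 0)"
    by (intro tendsto_intros)
  then have "eventually (\<lambda>x. \<bar>poly g 0\<bar> / 2 < \<bar>poly g x\<bar>) (at_right 0)"
    using g0 by (intro order_tendstoD) auto
  moreover have "eventually (\<lambda>x::real. x > 0) (at_right 0)" by (rule eventually_at_right_less)
  ultimately have "eventually (\<lambda>x. \<bar>poly g 0\<bar> / 2 * x ^ M \<le> \<bar>poly D x\<bar>) (at_right 0)"
    by eventually_elim (simp add: D abs_mult mult.commute)
  then show ?thesis using that[of "\<bar>poly g 0\<bar> / 2"] g0 by simp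
qed

lemma poly2_lipschitz:
  obtains L where "L > 0"
    "\<And>x y y'. \<bar>x\<bar> \<le> 1 \<Longrightarrow> \<bar>y\<bar> \<le> 1 \<Longrightarrow> \<bar>y'\<bar> \<le> 1 \<Longrightarrow>
       \<bar>poly2 F x y - poly2 F x y'\<bar> \<le> L * \<bar>y - y'\<bar>"
proof -
  obtain L where L: "L > 0" "\<And>x y. \<bar>x\<bar> \<le> 1 \<Longrightarrow> \<bar>y\<bar> \<le> 1 \<Longrightarrow> \<bar>poly2 (pderiv F) x y\<bar> \<le> L"
    by (rule poly2_bounded[of 1 "pderiv F"]) (rule that)
  have "\<bar>poly2 F x y - poly2 F x y'\<bar> \<le> L * \<bar>y - y'\<bar>"
    if "\<bar>x\<bar> \<le> 1" "\<bar>y\<bar> \<le> 1" "\<bar>y'\<bar> \<le> 1" for x y y'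
  proof -
    have "norm (poly2 F x y - poly2 F x y') \<le> L * norm (y - y')"
      by (rule field_differentiable_bound[of "{-1..1}" _ "poly2 (pderiv F) x"])
         (use that L(2) in \<open>auto intro: has_field_derivative_at_within[OF poly2_pderiv]\<close>)
    then show ?thesis by simp
  qed
  then show ?thesis using that L(1) by blast
qed

text \<open>The first case disposes of maxima on the boundary, with \<open>c = \<plusminus>1\<close>, and of polynomials \<open>F\<close> that do
not depend on \<open>y\<close>, with \<open>c = 0\<close>.\<close>

lemma positive_along_curve:
  assumes sector: "\<And>\<delta>. \<delta> > 0 \<Longrightarrow> \<exists>x y. 0 < x \<and> x < \<delta> \<and> \<bar>y\<bar> \<le> x \<and> poly2 F x y > 0"
  shows "\<exists>\<Phi>\<in>type_I. \<forall>\<delta>>0. \<exists>x. 0 < x \<and> x < \<delta> \<and> poly2 F x (\<Phi> x) > 0"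
proof (cases "\<exists>c. \<forall>\<delta>>0. \<exists>x. 0 < x \<and> x < \<delta> \<and> poly2 F x (c * x) > 0")
  case True
  then obtain c where c: "\<And>\<delta>. \<delta> > 0 \<Longrightarrow> \<exists>x. 0 < x \<and> x < \<delta> \<and> poly2 F x (c * x) > 0" by blast
  have "(\<lambda>t. c * t powr of_rat 1 + 0) \<in> genpoly 1"
    by (intro genpoly.add genpoly.zero) auto
  from genpoly_type_I[OF this] have "(\<lambda>t. c * \<bar>t\<bar>) \<in> type_I" by simp
  then show ?thesis
  proof (rule bexI[rotated], intro allI impI)
    fix \<delta> :: real assume "\<delta> > 0"
    then obtain x where "0 < x" "x < \<delta>" "poly2 F x (c * x) > 0" using c by blast
    then show "\<exists>x. 0 < x \<and> x < \<delta> \<and> poly2 F x (c * \<bar>x\<bar>) > 0" by (intro exI[of _ x]) simp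
  qed
next
  case False
  then have "\<exists>\<delta>>0. \<forall>x. 0 < x \<longrightarrow> x < \<delta> \<longrightarrow> poly2 F x (c * x) \<le> 0" for c
    by (meson not_le)
  from this[of 1] this[of "-1"] this[of 0] obtain \<delta>1 \<delta>2 \<delta>3 where \<delta>: "\<delta>1 > 0" "\<delta>2 > 0" "\<delta>3 > 0"
    "\<And>x. 0 < x \<Longrightarrow> x < \<delta>1 \<Longrightarrow> poly2 F x x \<le> 0"
    "\<And>x. 0 < x \<Longrightarrow> x < \<delta>2 \<Longrightarrow> poly2 F x (- x) \<le> 0"
    "\<And>x. 0 < x \<Longrightarrow> x < \<delta>3 \<Longrightarrow> poly2 F x 0 \<le> 0" by auto
  define \<delta> where "\<delta> = min 1 (min \<delta>1 (min \<delta>2 \<delta>3))"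
  have "\<delta> > 0" using \<delta>(1-3) by (simp add: \<delta>_def)
  have "\<exists>x z. 0 < x \<and> x < \<delta> / real (Suc n) \<and> \<bar>z\<bar> \<le> x \<and> poly2 F x z > 0 \<and> poly2 (pderiv F) x z = 0" for n
  proof -
    have "\<delta> / real (Suc n) > 0" using \<open>\<delta> > 0\<close> by simp
    then obtain x y where xy: "0 < x" "x < \<delta> / real (Suc n)" "\<bar>y\<bar> \<le> x" "poly2 F x y > 0"
      using sector by blast
    have "\<delta> / real (Suc n) \<le> \<delta>" using \<open>\<delta> > 0\<close> by (simp add: field_simps)
    then have x\<delta>: "x < \<delta>1" "x < \<delta>2" using xy(2) by (auto simp: \<delta>_def)
    have "continuous_on {-x..x} (poly2 F x)"
      by (rule DERIV_continuous_on) (rule has_field_derivative_at_within[OF poly2_pderiv])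
    then obtain z where z: "z \<in> {-x..x}" "\<And>y. y \<in> {-x..x} \<Longrightarrow> poly2 F x y \<le> poly2 F x z"
      using continuous_attains_sup[of "{-x..x}" "poly2 F x"] xy(1) by auto
    have pos: "poly2 F x z > 0"
      using z(2)[of y] xy(3,4) by (auto simp: abs_le_iff)
    then have "z \<noteq> x" "z \<noteq> - x" using \<delta>(4,5)[OF xy(1)] x\<delta> by force+
    then have "-x < z" "z < x" using z(1) by auto
    then have "poly2 (pderiv F) x z = 0"
      by (intro DERIV_local_max[OF poly2_pderiv, of "min (x - z) (z + x)"]) (auto intro!: z(2))
    then show ?thesis using xy(1,2) pos z(1) by (intro exI[of _ x] exI[of _ z]) auto
  qed
  then obtain x z where xz: "\<And>n. 0 < x n" "\<And>n. x n < \<delta> / real (Suc n)" "\<And>n. \<bar>z n\<bar> \<le> x n"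
    "\<And>n. poly2 F (x n) (z n) > 0" "\<And>n. poly2 (pderiv F) (x n) (z n) = 0" by metis
  have x\<delta>: "x n < \<delta>" for n
  proof -
    have "\<delta> / real (Suc n) \<le> \<delta>" using \<open>\<delta> > 0\<close> by (simp add: field_simps)
    then show ?thesis using xz(2)[of n] by simp
  qed
  then have x1: "x n \<le> 1" "x n < \<delta>3" for n by (auto simp: \<delta>_def less_imp_le)
  have x0: "x \<longlonglongrightarrow> 0"
  proof (rule tendsto_sandwich[OF _ _ tendsto_const])
    show "(\<lambda>n. \<delta> / real (Suc n)) \<longlonglongrightarrow> 0"
      using LIMSEQ_Suc[OF lim_const_over_n[of \<delta>]] by simp
  qed (use xz(1,2) in \<open>auto intro!: always_eventually less_imp_le\<close>)
  have "pderiv F \<noteq> 0"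
  proof
    assume "pderiv F = 0"
    then obtain h where "F = [:h:]" by (auto simp: pderiv_eq_0_iff elim: degree_eq_zeroE)
    then show False using xz(4)[of 0] \<delta>(6)[OF xz(1) x1(2), of 0] by simp
  qed
  then obtain D C where DC: "D \<noteq> 0" "C > 0" "\<And>x y. \<bar>x\<bar> \<le> 1 \<Longrightarrow> \<bar>y\<bar> \<le> 1 \<Longrightarrow>
      poly2 (pderiv F) x y = 0 \<Longrightarrow> poly2 F x y = 0 \<or> C * \<bar>poly D x\<bar> \<le> \<bar>poly2 F x y\<bar>"
    using value_on_zero_set[of "pderiv F" F] by blast
  obtain \<eta> M where \<eta>: "\<eta> > 0" "eventually (\<lambda>x. \<eta> * x ^ M \<le> \<bar>poly D x\<bar>) (at_right 0)"
    using lower_bound_near_0[OF DC(1)] by blast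
  obtain L where L: "L > 0" "\<And>x y y'. \<bar>x\<bar> \<le> 1 \<Longrightarrow> \<bar>y\<bar> \<le> 1 \<Longrightarrow> \<bar>y'\<bar> \<le> 1 \<Longrightarrow>
       \<bar>poly2 F x y - poly2 F x y'\<bar> \<le> L * \<bar>y - y'\<bar>"
    using poly2_lipschitz[of F] by blast
  obtain \<Phi> C' and r :: "nat \<Rightarrow> nat" where \<Phi>: "\<Phi> \<in> type_I" and r: "strict_mono r"
    and bound: "\<And>n. \<bar>z (r n) - \<Phi> (x (r n))\<bar> \<le> C' * x (r n) ^ Suc M"
    using branch_type_I[OF \<open>pderiv F \<noteq> 0\<close> xz(1) x1(1) x0 xz(3,5), of M] by blast
  have xr: "(\<lambda>n. x (r n)) \<longlonglongrightarrow> 0"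
    using LIMSEQ_subseq_LIMSEQ[OF x0 r] by (simp add: o_def)
  then have "filterlim (\<lambda>n. x (r n)) (at_right 0) sequentially"
    by (rule tendsto_imp_filterlim_at_right) (simp add: xz(1))
  from eventually_compose_filterlim[OF \<eta>(2) this]
  have ev1: "eventually (\<lambda>n. \<eta> * x (r n) ^ M \<le> \<bar>poly D (x (r n))\<bar>) sequentially" .
  have ev2: "eventually (\<lambda>n. \<bar>\<Phi> (x (r n))\<bar> < 1) sequentially"
    using tendsto_rabs[OF type_I_tendsto_0[OF \<Phi> xr]] by (intro order_tendstoD(2)) auto
  have "(\<lambda>n. C * \<eta> - L * C' * x (r n)) \<longlonglongrightarrow> C * \<eta> - L * C' * 0"
    by (intro tendsto_intros xr)
  then have ev3: "eventually (\<lambda>n. C * \<eta> - L * C' * x (r n) > 0) sequentially"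
    using DC(2) \<eta>(1) by (intro order_tendstoD(1)[of _ "C * \<eta>"]) auto
  have ev: "eventually (\<lambda>n. poly2 F (x (r n)) (\<Phi> (x (r n))) > 0) sequentially"
    using ev1 ev2 ev3
  proof eventually_elim
    case (elim n)
    \<comment> \<open>With \<open>\<bar>z - \<Phi> x\<bar> \<le> C' x\<^sup>M\<^sup>+\<^sup>1\<close>, the Lipschitz error is smaller than the lower bound \<open>C \<eta> x\<^sup>M\<close> of \<open>F\<close>.\<close>
    let ?x = "x (r n)" and ?z = "z (r n)"
    have x: "0 < ?x" "?x \<le> 1" using xz(1) x1(1) by auto
    have z: "\<bar>?z\<bar> \<le> 1" using xz(3)[of "r n"] x(2) by simp
    have "C * (\<eta> * ?x ^ M) \<le> C * \<bar>poly D ?x\<bar>" using elim(1) DC(2) by simp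
    also have "\<dots> \<le> poly2 F ?x ?z"
      using DC(3)[of ?x ?z] x z xz(4)[of "r n"] xz(5)[of "r n"] by auto
    finally have "C * (\<eta> * ?x ^ M) \<le> poly2 F ?x ?z" .
    moreover have "poly2 F ?x ?z - poly2 F ?x (\<Phi> ?x) \<le> L * \<bar>?z - \<Phi> ?x\<bar>"
      using L(2)[of ?x ?z "\<Phi> ?x"] x z elim(2) by simp
    moreover have "L * \<bar>?z - \<Phi> ?x\<bar> \<le> L * (C' * ?x ^ Suc M)"
      using bound[of n] L(1) by simp
    moreover have "0 < ?x ^ M * (C * \<eta> - L * C' * ?x)" using elim(3) x by simp
    ultimately show ?case by (simp add: algebra_simps)
  qed
  show ?thesis
  proof (rule bexI[OF _ \<Phi>], intro allI impI)
    fix \<epsilon> :: real assume "\<epsilon> > 0"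
    then have "eventually (\<lambda>n. x (r n) < \<epsilon>) sequentially"
      using xr by (intro order_tendstoD(2)) auto
    with ev have "eventually (\<lambda>n. x (r n) < \<epsilon> \<and> poly2 F (x (r n)) (\<Phi> (x (r n))) > 0) sequentially"
      by (rule eventually_conj[rotated])
    then obtain n where "x (r n) < \<epsilon>" "poly2 F (x (r n)) (\<Phi> (x (r n))) > 0"
      by (auto simp: eventually_sequentially)
    then show "\<exists>x. 0 < x \<and> x < \<epsilon> \<and> poly2 F x (\<Phi> x) > 0" using xz(1) by blast
  qed
qed

section \<open>Limits of rational functions\<close>

lemma has_limit_metric_iff:
  fixes f :: "'a::metric_space \<rightharpoonup> real"
  shows "has_limit f z a \<longleftrightarrow>
    (\<forall>d>0. \<exists>w\<in>dom f. w \<noteq> z \<and> dist w z < d) \<and>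
    (\<forall>e>0. \<exists>d>0. \<forall>w v. f w = Some v \<longrightarrow> w \<noteq> z \<longrightarrow> dist w z < d \<longrightarrow> \<bar>v - a\<bar> < e)"
proof -
  have "(\<forall>w\<in>dom f. 0 < dist w z \<and> dist w z < d \<longrightarrow> dist (the (f w)) a < e) \<longleftrightarrow>
      (\<forall>w v. f w = Some v \<longrightarrow> w \<noteq> z \<longrightarrow> dist w z < d \<longrightarrow> \<bar>v - a\<bar> < e)" for d e
    by (auto simp: dom_def dist_real_def)
  then show ?thesis unfolding has_limit_def islimpt_approachable Lim_within by simp
qed

lemma has_limit_near:
  fixes f :: "'a::metric_space \<rightharpoonup> real"
  assumes "has_limit f z a" "e > 0"
  shows "\<exists>d>0. \<forall>w v. f w = Some v \<longrightarrow> w \<noteq> z \<longrightarrow> dist w z < d \<longrightarrow> \<bar>v - a\<bar> < e"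
  using assms unfolding has_limit_metric_iff by blast

lemma has_limit_witness:
  fixes f :: "'a::metric_space \<rightharpoonup> real"
  assumes "has_limit f z a" "e > 0" "d > 0"
  obtains w v where "w \<noteq> z" "dist w z < d" "f w = Some v" "\<bar>v - a\<bar> < e"
proof -
  obtain d' where d': "d' > 0"
    "\<And>w v. f w = Some v \<Longrightarrow> w \<noteq> z \<Longrightarrow> dist w z < d' \<Longrightarrow> \<bar>v - a\<bar> < e"
    using assms(1,2) unfolding has_limit_metric_iff by blast
  then obtain w where "w \<in> dom f" "w \<noteq> z" "dist w z < min d d'"
    using assms(1,3) unfolding has_limit_metric_iff by (metis min_less_iff_conj)
  then show ?thesis using that d'(2) by auto
qed

lemma rational_function_eq:
  assumes "poly2 q x y \<noteq> 0"
  shows "rational_function p q (x, y) = Some (poly2 p x y / poly2 q x y)"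
  using assms by (simp add: rational_function_def quotient_def)

text \<open>The value at a zero of \<open>q\<close> is an iterated limit, hence it is approximated by values of \<open>p/q\<close> off the
zeros of \<open>q\<close>. Exceptional values therefore never have to be looked at separately.\<close>

lemma rational_function_near:
  assumes "rational_function p q (x, y) = Some v" "e > 0" "d > 0"
  obtains x' y' where "\<bar>x' - x\<bar> < d" "\<bar>y' - y\<bar> < d" "poly2 q x' y' \<noteq> 0"
    "\<bar>poly2 p x' y' / poly2 q x' y' - v\<bar> < e"
proof (cases "poly2 q x y = 0")
  case False
  then show ?thesis using that[of x y] assms by (simp add: rational_function_eq)
next
  case True
  define inner where "inner = (\<lambda>x. finite_limit (\<lambda>y. quotient p q (x, y)) y)"
  have "has_limit inner x v"
    using True assms(1)
    by (simp add: rational_function_def iterated_limit_def inner_def finite_limit_eq_Some_iff)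
  then obtain x' v' where x': "dist x' x < d" "inner x' = Some v'" "\<bar>v' - v\<bar> < e / 2"
    using has_limit_witness[of inner x v "e / 2" d] assms(2,3) by (metis half_gt_zero)
  then have "has_limit (\<lambda>y. quotient p q (x', y)) y v'"
    by (simp add: inner_def finite_limit_eq_Some_iff)
  then obtain y' v'' where y': "dist y' y < d" "quotient p q (x', y') = Some v''" "\<bar>v'' - v'\<bar> < e / 2"
    using has_limit_witness[of "\<lambda>y. quotient p q (x', y)" y v' "e / 2" d] assms(2,3)
    by (metis half_gt_zero)
  then have "poly2 q x' y' \<noteq> 0" "v'' = poly2 p x' y' / poly2 q x' y'"
    by (auto simp: quotient_def split: if_splits)
  moreover have "\<bar>v'' - v\<bar> < e" using x'(3) y'(3) by linarith
  ultimately show ?thesis using that[of x' y'] x'(1) y'(1) by (simp add: dist_real_def)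
qed

lemma isolated_zeros:
  fixes P :: "real poly"
  assumes "P \<noteq> 0"
  obtains d where "d > 0" "\<And>x. x \<noteq> c \<Longrightarrow> \<bar>x - c\<bar> < d \<Longrightarrow> poly P x \<noteq> 0"
proof -
  obtain d where "d > 0" "\<forall>x\<in>{x. poly P x = 0}. x \<noteq> c \<longrightarrow> d \<le> dist c x"
    using finite_set_avoid[OF poly_roots_finite[OF assms], of c] by blast
  then show ?thesis using that[of d] by (force simp: dist_real_def)
qed

text \<open>By the Bezout identity the common zeros lie on finitely many vertical lines. On the line \<open>x = x0\<close> one
of the two slices is nonzero, since otherwise \<open>x - x0\<close> would be a common factor.\<close>

lemma isolated_common_zeros:
  fixes p q :: "real poly poly"
  assumes "coprime p q" "q \<noteq> 0"
  obtains d where "d > 0" "\<And>x y. (x, y) \<noteq> (x0, y0) \<Longrightarrow> \<bar>x - x0\<bar> < d \<Longrightarrow> \<bar>y - y0\<bar> < d \<Longrightarrow>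
    poly2 q x y = 0 \<Longrightarrow> poly2 p x y \<noteq> 0"
proof -
  obtain A B D where D: "D \<noteq> 0" "A * p + B * q = [:D:]"
    by (rule coprime_bezout[OF assms])
  obtain d1 where d1: "d1 > 0" "\<And>x. x \<noteq> x0 \<Longrightarrow> \<bar>x - x0\<bar> < d1 \<Longrightarrow> poly D x \<noteq> 0"
    by (rule isolated_zeros[OF D(1), of x0]) (rule that)
  have "\<not> (slice p x0 = 0 \<and> slice q x0 = 0)"
  proof
    assume *: "slice p x0 = 0 \<and> slice q x0 = 0"
    then have "poly (coeff p n) x0 = 0" "poly (coeff q n) x0 = 0" for n
      using coeff_slice[of p x0 n] coeff_slice[of q x0 n] by simp_all
    then have "[:[:-x0, 1:]:] dvd p" "[:[:-x0, 1:]:] dvd q"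
      by (simp_all add: const_poly_dvd_iff poly_eq_0_iff_dvd)
    with assms(1) have "is_unit [:[:-x0, 1:]:]" by (rule coprime_common_divisor)
    then have "is_unit [:-x0, 1:]" by (simp only: is_unit_const_poly_iff)
    then show False by (auto simp: is_unit_poly_iff)
  qed
  then obtain P where P: "P \<noteq> 0" "P = slice p x0 \<or> P = slice q x0" by metis
  obtain d2 where d2: "d2 > 0" "\<And>y. y \<noteq> y0 \<Longrightarrow> \<bar>y - y0\<bar> < d2 \<Longrightarrow> poly P y \<noteq> 0"
    by (rule isolated_zeros[OF P(1), of y0]) (rule that)
  have "poly2 p x y \<noteq> 0" if "(x, y) \<noteq> (x0, y0)" "\<bar>x - x0\<bar> < min d1 d2" "\<bar>y - y0\<bar> < min d1 d2"
    "poly2 q x y = 0" for x y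
  proof
    assume p0: "poly2 p x y = 0"
    show False
    proof (cases "x = x0")
      case True
      then have "poly P y \<noteq> 0" using that d2(2) by auto
      then show False using P(2) p0 that(4) True by (auto simp: poly_slice)
    next
      case False
      then have "poly D x \<noteq> 0" using that d1(2) by auto
      moreover have "poly D x = poly2 (A * p + B * q) x y" by (simp only: D(2) poly2_simps)
      ultimately show False using p0 that(4) by simp
    qed
  qed
  moreover have "min d1 d2 > 0" using d1(1) d2(1) by simp
  ultimately show ?thesis by (rule that[rotated])
qed

text \<open>Near the centre \<open>\<bar>p\<bar> \<le> (\<bar>a\<bar> + 1) \<bar>q\<bar>\<close> holds off the zeros of \<open>q\<close>, which are nowhere dense. By
continuity it holds at the zeros of \<open>q\<close> too and makes them common zeros.\<close>

lemma denominator_nonzero_near: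
  assumes "coprime p q" "q \<noteq> 0" and lim: "has_limit (rational_function p q) (x0, y0) a"
  obtains d where "d > 0" "\<And>x y. (x, y) \<noteq> (x0, y0) \<Longrightarrow> \<bar>x - x0\<bar> < d \<Longrightarrow> \<bar>y - y0\<bar> < d \<Longrightarrow>
    poly2 q x y \<noteq> 0"
proof -
  obtain d1 where d1: "d1 > 0" "\<And>w v. rational_function p q w = Some v \<Longrightarrow> w \<noteq> (x0, y0) \<Longrightarrow>
      dist w (x0, y0) < d1 \<Longrightarrow> \<bar>v - a\<bar> < 1"
    using lim unfolding has_limit_metric_iff by (metis zero_less_one)
  obtain d2 where d2: "d2 > 0" "\<And>x y. (x, y) \<noteq> (x0, y0) \<Longrightarrow> \<bar>x - x0\<bar> < d2 \<Longrightarrow> \<bar>y - y0\<bar> < d2 \<Longrightarrow>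
    poly2 q x y = 0 \<Longrightarrow> poly2 p x y \<noteq> 0"
    using isolated_common_zeros[OF assms(1,2), of x0 y0] by blast
  have "poly2 q x y \<noteq> 0" if z: "(x, y) \<noteq> (x0, y0)"
    and near: "\<bar>x - x0\<bar> < min d2 (d1 / 2)" "\<bar>y - y0\<bar> < min d2 (d1 / 2)" for x y
  proof
    assume q0: "poly2 q x y = 0"
    then have p0: "poly2 p x y \<noteq> 0" using d2(2) z near by auto
    have "\<exists>x' y'. \<bar>x' - x\<bar> < 1 / real (Suc n) \<and> \<bar>y' - y\<bar> < 1 / real (Suc n) \<and> poly2 q x' y' \<noteq> 0" for n
      by (rule nonzero_near[OF assms(2), of "1 / real (Suc n)" x y]) auto
    then obtain X Y where XY: "\<And>n. \<bar>X n - x\<bar> < 1 / real (Suc n)" "\<And>n. \<bar>Y n - y\<bar> < 1 / real (Suc n)"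
      "\<And>n. poly2 q (X n) (Y n) \<noteq> 0" by metis
    have X: "X \<longlonglongrightarrow> x" and Y: "Y \<longlonglongrightarrow> y"
      by (rule LIM_zero_cancel, rule Lim_null_comparison[OF _ LIMSEQ_inverse_real_of_nat],
          use XY(1,2) in \<open>auto intro!: always_eventually less_imp_le simp: inverse_eq_divide\<close>)+
    have "(\<lambda>n. (X n, Y n)) \<longlonglongrightarrow> (x, y)" using X Y by (rule tendsto_Pair)
    then have "eventually (\<lambda>n. (X n, Y n) \<noteq> (x0, y0)) sequentially"
      using z by (rule tendsto_imp_eventually_ne)
    moreover have "eventually (\<lambda>n. \<bar>X n - x0\<bar> < d1 / 2) sequentially"
      using near(1) by (intro order_tendstoD(2)[of _ "\<bar>x - x0\<bar>"] tendsto_intros X) auto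
    moreover have "eventually (\<lambda>n. \<bar>Y n - y0\<bar> < d1 / 2) sequentially"
      using near(2) by (intro order_tendstoD(2)[of _ "\<bar>y - y0\<bar>"] tendsto_intros Y) auto
    ultimately have ev: "eventually (\<lambda>n. \<bar>poly2 p (X n) (Y n)\<bar> \<le> (\<bar>a\<bar> + 1) * \<bar>poly2 q (X n) (Y n)\<bar>) sequentially"
    proof eventually_elim
      case (elim n)
      have "dist (X n, Y n) (x0, y0) \<le> \<bar>X n - x0\<bar> + \<bar>Y n - y0\<bar>"
        using sqrt_sum_squares_le_sum_abs by (simp add: dist_Pair_Pair dist_real_def)
      then have "\<bar>poly2 p (X n) (Y n) / poly2 q (X n) (Y n) - a\<bar> < 1"
        using elim by (intro d1(2)[OF rational_function_eq[OF XY(3)]]) auto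
      then have "\<bar>poly2 p (X n) (Y n) / poly2 q (X n) (Y n)\<bar> \<le> \<bar>a\<bar> + 1" by linarith
      then show ?case using XY(3)[of n] by (simp add: abs_divide divide_le_eq)
    qed
    have "\<bar>poly2 p x y\<bar> \<le> (\<bar>a\<bar> + 1) * \<bar>poly2 q x y\<bar>"
      by (rule tendsto_le[OF _ _ _ ev]) (auto intro!: tendsto_intros tendsto_poly2 X Y)
    then show False using q0 p0 by simp
  qed
  then show ?thesis using that[of "min d2 (d1 / 2)"] d1(1) d2(1) by auto
qed

lemma limit_along_curve:
  assumes lim: "has_limit f z a" and near: "d0 > 0" "\<And>w. w \<noteq> z \<Longrightarrow> dist w z < d0 \<Longrightarrow> w \<in> dom f"
    and c: "(\<gamma> \<longlongrightarrow> z) (at t0)" "\<And>t. t \<noteq> t0 \<Longrightarrow> \<gamma> t \<noteq> z"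
  shows "has_limit (\<lambda>t::real. f (\<gamma> t)) t0 a"
proof -
  have close: "\<exists>d'>0. \<forall>t. t \<noteq> t0 \<longrightarrow> dist t t0 < d' \<longrightarrow> dist (\<gamma> t) z < d" if "d > 0" for d
    using c(1) that unfolding Lim_at by (metis dist_nz)
  show ?thesis unfolding has_limit_metric_iff
  proof (intro conjI allI impI)
    fix d :: real assume "d > 0"
    obtain d' where d': "d' > 0" "\<And>t. t \<noteq> t0 \<Longrightarrow> dist t t0 < d' \<Longrightarrow> dist (\<gamma> t) z < d0"
      using close[OF near(1)] by blast
    define t where "t = t0 + min d d' / 2"
    have "t \<noteq> t0" "dist t t0 < min d d'" using \<open>d > 0\<close> d'(1) by (auto simp: t_def dist_real_def)
    moreover from this have "\<gamma> t \<in> dom f" using d'(2) c(2) near(2) by simp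
    ultimately show "\<exists>w\<in>dom (\<lambda>t. f (\<gamma> t)). w \<noteq> t0 \<and> dist w t0 < d" by auto
  next
    fix e :: real assume "e > 0"
    then obtain d where d: "d > 0" "\<And>w v. f w = Some v \<Longrightarrow> w \<noteq> z \<Longrightarrow> dist w z < d \<Longrightarrow> \<bar>v - a\<bar> < e"
      using lim unfolding has_limit_metric_iff by blast
    obtain d' where d': "d' > 0" "\<And>t. t \<noteq> t0 \<Longrightarrow> dist t t0 < d' \<Longrightarrow> dist (\<gamma> t) z < d"
      using close[OF d(1)] by blast
    then show "\<exists>d>0. \<forall>w v. f (\<gamma> w) = Some v \<longrightarrow> w \<noteq> t0 \<longrightarrow> dist w t0 < d \<longrightarrow> \<bar>v - a\<bar> < e"
      using d(2) c(2) by blast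
  qed
qed

section \<open>The criterion\<close>

lemma coordinates_near:
  fixes x y x0 y0 d :: real
  assumes "x \<noteq> x0 \<or> y \<noteq> y0" "\<bar>x - x0\<bar> < d" "\<bar>y - y0\<bar> < d"
  obtains r where "r > 0" "\<And>x' y'. \<bar>x' - x\<bar> < r \<Longrightarrow> \<bar>y' - y\<bar> < r \<Longrightarrow>
    (x' \<noteq> x0 \<or> y' \<noteq> y0) \<and> \<bar>x' - x0\<bar> < d \<and> \<bar>y' - y0\<bar> < d"
proof -
  define \<mu> where "\<mu> = max \<bar>x - x0\<bar> \<bar>y - y0\<bar>"
  have \<mu>: "0 < \<mu>" "\<mu> < d" using assms by (auto simp: \<mu>_def less_max_iff_disj)
  show ?thesis
  proof (rule that[of "min \<mu> (d - \<mu>)"])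
    show "min \<mu> (d - \<mu>) > 0" using \<mu> by simp
    fix x' y' assume near: "\<bar>x' - x\<bar> < min \<mu> (d - \<mu>)" "\<bar>y' - y\<bar> < min \<mu> (d - \<mu>)"
    have "\<bar>x - x0\<bar> \<le> \<mu>" "\<bar>y - y0\<bar> \<le> \<mu>" by (auto simp: \<mu>_def)
    then have "\<bar>x' - x0\<bar> < d" "\<bar>y' - y0\<bar> < d" using near by linarith+
    moreover have "x' \<noteq> x0 \<or> y' \<noteq> y0"
    proof (rule ccontr)
      assume "\<not> ?thesis"
      then have "\<bar>x - x0\<bar> < \<mu>" "\<bar>y - y0\<bar> < \<mu>" using near by (auto simp: abs_minus_commute)
      then show False by (simp add: \<mu>_def)
    qed
    ultimately show "(x' \<noteq> x0 \<or> y' \<noteq> y0) \<and> \<bar>x' - x0\<bar> < d \<and> \<bar>y' - y0\<bar> < d" by simp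
  qed
qed

text \<open>The four sectors \<open>\<bar>y\<bar> \<le> \<plusminus>x\<close> and \<open>\<bar>x\<bar> \<le> \<plusminus>y\<close> cover the plane, so one of them contains positive points
arbitrarily close to the origin.\<close>

lemma positive_sector:
  fixes g :: "real \<Rightarrow> real \<Rightarrow> real"
  assumes "\<And>d. d > 0 \<Longrightarrow> \<exists>x y. (x \<noteq> 0 \<or> y \<noteq> 0) \<and> \<bar>x\<bar> < d \<and> \<bar>y\<bar> < d \<and> g x y > 0"
  shows "\<exists>\<sigma>\<in>{1, -1}. (\<forall>d>0. \<exists>x y. 0 < x \<and> x < d \<and> \<bar>y\<bar> \<le> x \<and> g (\<sigma> * x) y > 0) \<or>
                   (\<forall>d>0. \<exists>x y. 0 < x \<and> x < d \<and> \<bar>y\<bar> \<le> x \<and> g y (\<sigma> * x) > 0)"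
proof (rule ccontr)
  assume neg: "\<not> ?thesis"
  have none: "\<exists>d>0. \<forall>x y. 0 < x \<longrightarrow> x < d \<longrightarrow> \<bar>y\<bar> \<le> x \<longrightarrow> \<not> g (\<sigma> * x) y > 0"
    "\<exists>d>0. \<forall>x y. 0 < x \<longrightarrow> x < d \<longrightarrow> \<bar>y\<bar> \<le> x \<longrightarrow> \<not> g y (\<sigma> * x) > 0" if "\<sigma> \<in> {1, -1}" for \<sigma>
    using neg that by meson+
  obtain d1 where d1: "d1 > 0" "\<And>x y. 0 < x \<Longrightarrow> x < d1 \<Longrightarrow> \<bar>y\<bar> \<le> x \<Longrightarrow> \<not> g x y > 0"
    using none(1)[of 1] by auto
  obtain d2 where d2: "d2 > 0" "\<And>x y. 0 < x \<Longrightarrow> x < d2 \<Longrightarrow> \<bar>y\<bar> \<le> x \<Longrightarrow> \<not> g (- x) y > 0"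
    using none(1)[of "-1"] by auto
  obtain d3 where d3: "d3 > 0" "\<And>x y. 0 < x \<Longrightarrow> x < d3 \<Longrightarrow> \<bar>y\<bar> \<le> x \<Longrightarrow> \<not> g y x > 0"
    using none(2)[of 1] by auto
  obtain d4 where d4: "d4 > 0" "\<And>x y. 0 < x \<Longrightarrow> x < d4 \<Longrightarrow> \<bar>y\<bar> \<le> x \<Longrightarrow> \<not> g y (- x) > 0"
    using none(2)[of "-1"] by auto
  define d where "d = min (min d1 d2) (min d3 d4)"
  have "d > 0" using d1(1) d2(1) d3(1) d4(1) by (simp add: d_def)
  then obtain x y where xy: "x \<noteq> 0 \<or> y \<noteq> 0" "\<bar>x\<bar> < d" "\<bar>y\<bar> < d" "g x y > 0"
    using assms by blast
  consider "0 < x" "\<bar>y\<bar> \<le> x" | "x < 0" "\<bar>y\<bar> \<le> - x" | "0 < y" "\<bar>x\<bar> \<le> y" | "y < 0" "\<bar>x\<bar> \<le> - y"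
    using xy(1) by linarith
  then show False
    using d1(2)[of x y] d2(2)[of "- x" y] d3(2)[of y x] d4(2)[of "- y" x] xy(2-4)
    by cases (auto simp: d_def)
qed

text \<open>A sequence of bad points gives a bad type I curve by \<open>positive_along_curve\<close>. In the sectors with
\<open>\<sigma> = - 1\<close> the curve is traversed at negative parameters, where it is the same since type I
functions are even.\<close>

lemma limit_from_curves:
  assumes curves: "\<And>\<Phi>. \<Phi> \<in> type_I \<Longrightarrow>
      has_limit (\<lambda>x. rational_function p q (x, y0 + \<Phi> (x - x0))) x0 a \<and>
      has_limit (\<lambda>y. rational_function p q (x0 + \<Phi> (y - y0), y)) y0 a"
  shows "has_limit (rational_function p q) (x0, y0) a"
  unfolding has_limit_metric_iff
proof (intro conjI allI impI)
  fix d :: real assume "d > 0"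
  have "(\<lambda>t. 0) \<in> type_I" using genpoly_type_I[OF genpoly.zero] by simp
  from curves[OF this] have "has_limit (\<lambda>x. rational_function p q (x, y0)) x0 a" by simp
  then obtain x v where "x \<noteq> x0" "dist x x0 < d" "rational_function p q (x, y0) = Some v"
    using \<open>d > 0\<close> by (metis has_limit_witness)
  then show "\<exists>w\<in>dom (rational_function p q). w \<noteq> (x0, y0) \<and> dist w (x0, y0) < d"
    by (intro bexI[of _ "(x, y0)"]) (auto simp: dist_Pair_Pair)
next
  fix e :: real assume "e > 0"
  show "\<exists>d>0. \<forall>w v. rational_function p q w = Some v \<longrightarrow> w \<noteq> (x0, y0) \<longrightarrow>
          dist w (x0, y0) < d \<longrightarrow> \<bar>v - a\<bar> < e"
  proof (rule ccontr)
    assume contra: "\<not> ?thesis"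
    define p' q' where "p' = poly2 p" and "q' = poly2 q"
    \<comment> \<open>The factor \<open>q\<^sup>2\<close> excludes the zeros of \<open>q\<close> from \<open>g > 0\<close>.\<close>
    define g where "g = (\<lambda>x y. ((p' (x0 + x) (y0 + y) - a * q' (x0 + x) (y0 + y))\<^sup>2
      - (e / 2)\<^sup>2 * (q' (x0 + x) (y0 + y))\<^sup>2) * (q' (x0 + x) (y0 + y))\<^sup>2)"
    have g_pos: "g x y > 0 \<longleftrightarrow> q' (x0 + x) (y0 + y) \<noteq> 0 \<and>
        e / 2 < \<bar>p' (x0 + x) (y0 + y) / q' (x0 + x) (y0 + y) - a\<bar>" for x y
    proof (cases "q' (x0 + x) (y0 + y) = 0")
      case False
      define P Q where "P = p' (x0 + x) (y0 + y)" and "Q = q' (x0 + x) (y0 + y)"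
      have "Q \<noteq> 0" using False by (simp add: Q_def)
      have "g x y > 0 \<longleftrightarrow> (e / 2)\<^sup>2 * Q\<^sup>2 < (P - a * Q)\<^sup>2"
        using \<open>Q \<noteq> 0\<close> by (simp add: g_def P_def Q_def zero_less_mult_iff)
      also have "(e / 2)\<^sup>2 * Q\<^sup>2 = (e / 2 * Q)\<^sup>2" by (rule power_mult_distrib[symmetric])
      also have "(e / 2 * Q)\<^sup>2 < (P - a * Q)\<^sup>2 \<longleftrightarrow> \<bar>e / 2 * Q\<bar> < \<bar>P - a * Q\<bar>" by (metis abs_le_square_iff not_le)
      also have "P - a * Q = (P / Q - a) * Q" using \<open>Q \<noteq> 0\<close> by (simp add: field_simps)
      also have "\<bar>e / 2 * Q\<bar> < \<bar>(P / Q - a) * Q\<bar> \<longleftrightarrow> e / 2 < \<bar>P / Q - a\<bar>"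
        using \<open>Q \<noteq> 0\<close> \<open>e > 0\<close> by (simp add: abs_mult)
      finally show ?thesis using False by (simp add: P_def Q_def)
    qed (simp add: g_def)
    have bip: "bipoly (\<lambda>x y. g (u x y) (v x y))" if "bipoly u" "bipoly v" for u v
      unfolding g_def p'_def q'_def
      by (intro bipoly_intros bipoly_compose that)
    have "\<exists>x y. (x \<noteq> 0 \<or> y \<noteq> 0) \<and> \<bar>x\<bar> < d \<and> \<bar>y\<bar> < d \<and> g x y > 0" if "d > 0" for d
    proof -
      obtain w v where w: "rational_function p q w = Some v" "w \<noteq> (x0, y0)"
        "dist w (x0, y0) < d" "\<not> \<bar>v - a\<bar> < e"
        using contra \<open>d > 0\<close> by meson
      obtain x y where "w = (x, y)" by (cases w)
      with w have xy: "rational_function p q (x, y) = Some v" "x \<noteq> x0 \<or> y \<noteq> y0"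
        "dist (x, y) (x0, y0) < d" "\<bar>v - a\<bar> \<ge> e"
        by auto
      have "\<bar>x - x0\<bar> < d" "\<bar>y - y0\<bar> < d"
        using xy(3) dist_fst_le[of "(x, y)" "(x0, y0)"] dist_snd_le[of "(x, y)" "(x0, y0)"]
        by (simp_all add: dist_real_def)
      then obtain r where r: "r > 0" "\<And>x' y'. \<bar>x' - x\<bar> < r \<Longrightarrow> \<bar>y' - y\<bar> < r \<Longrightarrow>
          (x' \<noteq> x0 \<or> y' \<noteq> y0) \<and> \<bar>x' - x0\<bar> < d \<and> \<bar>y' - y0\<bar> < d"
        using coordinates_near[OF xy(2)] by metis
      obtain x' y' where "\<bar>x' - x\<bar> < r" "\<bar>y' - y\<bar> < r" "poly2 q x' y' \<noteq> 0"
        "\<bar>poly2 p x' y' / poly2 q x' y' - v\<bar> < e / 2"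
        using rational_function_near[OF xy(1) half_gt_zero[OF \<open>e > 0\<close>] r(1)] by metis
      moreover from this have "e / 2 < \<bar>poly2 p x' y' / poly2 q x' y' - a\<bar>"
        using xy(4) by linarith
      ultimately show ?thesis
        using r(2)[of x' y'] by (intro exI[of _ "x' - x0"] exI[of _ "y' - y0"]) (simp add: g_pos p'_def q'_def)
    qed
    then have "\<exists>\<sigma>\<in>{1, -1}. (\<forall>d>0. \<exists>x y. 0 < x \<and> x < d \<and> \<bar>y\<bar> \<le> x \<and> g (\<sigma> * x) y > 0) \<or>
                   (\<forall>d>0. \<exists>x y. 0 < x \<and> x < d \<and> \<bar>y\<bar> \<le> x \<and> g y (\<sigma> * x) > 0)"
      by (rule positive_sector)
    then obtain \<sigma> :: real where \<sigma>: "\<sigma> \<in> {1, -1}"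
      and sector: "(\<forall>d>0. \<exists>x y. 0 < x \<and> x < d \<and> \<bar>y\<bar> \<le> x \<and> g (\<sigma> * x) y > 0) \<or>
                   (\<forall>d>0. \<exists>x y. 0 < x \<and> x < d \<and> \<bar>y\<bar> \<le> x \<and> g y (\<sigma> * x) > 0)" by (rule bexE)
    have even: "\<Phi> (\<sigma> * t) = \<Phi> t" if "\<Phi> \<in> type_I" for \<Phi> t
      using \<sigma> type_I_minus[OF that] by auto
    have \<sigma>t: "\<bar>\<sigma> * t\<bar> = \<bar>t\<bar>" for t using \<sigma> by auto
    from sector show False
    proof
      assume sec: "\<forall>d>0. \<exists>x y. 0 < x \<and> x < d \<and> \<bar>y\<bar> \<le> x \<and> g (\<sigma> * x) y > 0"
      obtain F where F: "\<And>x y. poly2 F x y = g (\<sigma> * x) y"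
        using bip[OF bipoly_mult[OF bipoly_const bipoly_fst] bipoly_snd] unfolding bipoly_def by metis
      have "\<exists>\<Phi>\<in>type_I. \<forall>d>0. \<exists>x. 0 < x \<and> x < d \<and> poly2 F x (\<Phi> x) > 0"
        by (rule positive_along_curve) (use sec in \<open>simp add: F\<close>)
      then obtain \<Phi> where \<Phi>: "\<Phi> \<in> type_I" "\<forall>d>0. \<exists>x. 0 < x \<and> x < d \<and> g (\<sigma> * x) (\<Phi> x) > 0"
        unfolding F by (rule bexE)
      have "has_limit (\<lambda>x. rational_function p q (x, y0 + \<Phi> (x - x0))) x0 a"
        using curves[OF \<Phi>(1)] by (rule conjunct1)
      from has_limit_near[OF this half_gt_zero[OF \<open>e > 0\<close>]] obtain d where d: "d > 0"
        "\<And>x v. rational_function p q (x, y0 + \<Phi> (x - x0)) = Some v \<Longrightarrow>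
          x \<noteq> x0 \<Longrightarrow> dist x x0 < d \<Longrightarrow> \<bar>v - a\<bar> < e / 2" by auto
      obtain t where t: "0 < t" "t < d" "g (\<sigma> * t) (\<Phi> t) > 0" using \<Phi>(2) d(1) by blast
      have "rational_function p q (x0 + \<sigma> * t, y0 + \<Phi> (x0 + \<sigma> * t - x0)) =
          Some (p' (x0 + \<sigma> * t) (y0 + \<Phi> t) / q' (x0 + \<sigma> * t) (y0 + \<Phi> t))"
        using t(3) unfolding g_pos p'_def q'_def by (simp add: even[OF \<Phi>(1)] rational_function_eq)
      from d(2)[OF this] show False
        using t \<sigma> \<sigma>t[of t] unfolding g_pos by (auto simp: dist_real_def)
    next
      assume sec: "\<forall>d>0. \<exists>x y. 0 < x \<and> x < d \<and> \<bar>y\<bar> \<le> x \<and> g y (\<sigma> * x) > 0"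
      obtain F where F: "\<And>x y. poly2 F x y = g y (\<sigma> * x)"
        using bip[OF bipoly_snd bipoly_mult[OF bipoly_const bipoly_fst]] unfolding bipoly_def by metis
      have "\<exists>\<Phi>\<in>type_I. \<forall>d>0. \<exists>x. 0 < x \<and> x < d \<and> poly2 F x (\<Phi> x) > 0"
        by (rule positive_along_curve) (use sec in \<open>simp add: F\<close>)
      then obtain \<Phi> where \<Phi>: "\<Phi> \<in> type_I" "\<forall>d>0. \<exists>x. 0 < x \<and> x < d \<and> g (\<Phi> x) (\<sigma> * x) > 0"
        unfolding F by (rule bexE)
      have "has_limit (\<lambda>y. rational_function p q (x0 + \<Phi> (y - y0), y)) y0 a"
        using curves[OF \<Phi>(1)] by (rule conjunct2)
      from has_limit_near[OF this half_gt_zero[OF \<open>e > 0\<close>]] obtain d where d: "d > 0"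
        "\<And>y v. rational_function p q (x0 + \<Phi> (y - y0), y) = Some v \<Longrightarrow>
          y \<noteq> y0 \<Longrightarrow> dist y y0 < d \<Longrightarrow> \<bar>v - a\<bar> < e / 2" by auto
      obtain t where t: "0 < t" "t < d" "g (\<Phi> t) (\<sigma> * t) > 0" using \<Phi>(2) d(1) by blast
      have "rational_function p q (x0 + \<Phi> (y0 + \<sigma> * t - y0), y0 + \<sigma> * t) =
          Some (p' (x0 + \<Phi> t) (y0 + \<sigma> * t) / q' (x0 + \<Phi> t) (y0 + \<sigma> * t))"
        using t(3) unfolding g_pos p'_def q'_def by (simp add: even[OF \<Phi>(1)] rational_function_eq)
      from d(2)[OF this] show False
        using t \<sigma> \<sigma>t[of t] unfolding g_pos by (auto simp: dist_real_def)
    qed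
  qed
qed

theorem mainTheorem2:
  fixes p q :: "real poly poly" and x0 y0 a :: real
  assumes "coprime p q" and "q \<noteq> 0"
  defines "f \<equiv> rational_function p q"
  shows "has_limit f (x0, y0) a \<longleftrightarrow>
    (\<forall>\<Phi>\<in>type_I. has_limit (\<lambda>x. f (x, y0 + \<Phi> (x - x0))) x0 a \<and>
               has_limit (\<lambda>y. f (x0 + \<Phi> (y - y0), y)) y0 a)"
proof
  assume lim: "has_limit f (x0, y0) a"
  then obtain d where d: "d > 0" "\<And>x y. (x, y) \<noteq> (x0, y0) \<Longrightarrow> \<bar>x - x0\<bar> < d \<Longrightarrow> \<bar>y - y0\<bar> < d \<Longrightarrow>
    poly2 q x y \<noteq> 0"
    using denominator_nonzero_near[OF assms(1,2)] unfolding f_def by metis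
  have dom: "w \<in> dom f" if "w \<noteq> (x0, y0)" "dist w (x0, y0) < d" for w
  proof (cases w)
    case (Pair x y)
    have "\<bar>x - x0\<bar> < d" "\<bar>y - y0\<bar> < d"
      using that(2) dist_fst_le[of w "(x0, y0)"] dist_snd_le[of w "(x0, y0)"]
      by (simp_all add: dist_real_def Pair)
    then show ?thesis using d(2)[of x y] that(1) by (auto simp: Pair f_def rational_function_eq)
  qed
  show "\<forall>\<Phi>\<in>type_I. has_limit (\<lambda>x. f (x, y0 + \<Phi> (x - x0))) x0 a \<and>
               has_limit (\<lambda>y. f (x0 + \<Phi> (y - y0), y)) y0 a"
  proof
    fix \<Phi> assume \<Phi>: "\<Phi> \<in> type_I"
    have lin: "((\<lambda>t. t - c) \<longlongrightarrow> 0) (at c)" for c :: real by (auto intro!: tendsto_eq_intros)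
    have "((\<lambda>t. (t, y0 + \<Phi> (t - x0))) \<longlongrightarrow> (x0, y0 + 0)) (at x0)"
      by (intro tendsto_intros type_I_tendsto_0[OF \<Phi>] lin)
    moreover have "((\<lambda>t. (x0 + \<Phi> (t - y0), t)) \<longlongrightarrow> (x0 + 0, y0)) (at y0)"
      by (intro tendsto_intros type_I_tendsto_0[OF \<Phi>] lin)
    ultimately show "has_limit (\<lambda>x. f (x, y0 + \<Phi> (x - x0))) x0 a \<and>
               has_limit (\<lambda>y. f (x0 + \<Phi> (y - y0), y)) y0 a"
      by (auto intro!: limit_along_curve[OF lim d(1) dom])
  qed
next
  assume "\<forall>\<Phi>\<in>type_I. has_limit (\<lambda>x. f (x, y0 + \<Phi> (x - x0))) x0 a \<and>
               has_limit (\<lambda>y. f (x0 + \<Phi> (y - y0), y)) y0 a"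
  then show "has_limit f (x0, y0) a"
    unfolding f_def by (intro limit_from_curves) blast
qed

end
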